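(* Let $f\in L^1(\mathbb{R}^N)$, $f\ge 0$ a.e., be a nontrivial initial datum such that $\operatorname{supp}_{\mathcal D'}(f)=\operatorname{supp}_{\mathcal D'}((f-1)_+)$. Let $u$ be the $L^1$-solution of the nonlocal Stefan problem $\partial_t u=J*v-v$, $v=(u-1)_+$, $u(\cdot,0)=f$, and let $\mathcal M(t)$ be its mushy region at time $t$. Then $$\mathcal M(t)=\big\{x\in\mathbb{R}^N:\ 0<\operatorname{dist}\big(x,\operatorname{supp}_{\mathcal D'}(f)\big)<R_J\big\}\quad\text{for all } t\in(0,t_0],\qquad t_0=\frac{1}{\|J\|_{L^\infty(\mathbb{R}^N)}\|f\|_{L^1(\mathbb{R}^N)}} .$$
   Context: Standing assumptions: $J:\mathbb{R}^N\to[0,\infty)$ is continuous, compactly supported, radially symmetric, $\int_{\mathbb{R}^N}J=1$, and $R_J$ is the radius of the support of $J$. Here $*$ is convolution in space and $s_+=\max\{s,0\}$. For $f\in L^1(\mathbb{R}^N)$, the $L^1$-solution is the unique $u\in C([0,\infty);L^1(\mathbb{R}^N))$ such that for every $t>0$, $u(t)=f+\int_0^t(J*v(s)-v(s))\,ds$ with $v=(u-1)_+$ a.e. For a locally integrable $g\ge0$, $\operatorname{supp}_{\mathcal D'}(g)$ is the complement of the largest open set $\mathcal O$ such that the distribution associated to $g$ vanishes on $\mathcal O$. The mushy region at time $t\ge0$ of a nonnegative solution $u$ is $$\mathcal M(t)=\operatorname{Int}\Big(\operatorname{supp}_{\mathcal D'}(u(t))\setminus\operatorname{supp}_{\mathcal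 D'}((u(t)-1)_+)\Big),$$ where $\operatorname{Int}$ is the topological interior.
   Formalization: The identity fails where dist(·,supp f) has a local maximum equal to R_J (f=2 on [-2R,-R]∪[R,2R]); it is proved when there is none, and in general with Int{0<dist≤R_J} on the right. The support of J is taken to be the closed ball of radius R_J. *)

theory Defs
  imports "HOL-Analysis.Analysis" "HOL-Probability.Essential_Supremum"
begin

subsection \<open>Distributional support\<close>

fun C_k :: "nat \<Rightarrow> ('a::euclidean_space \<Rightarrow> real) \<Rightarrow> bool" where
  "C_k 0 \<phi> \<longleftrightarrow> continuous_on UNIV \<phi>"
| "C_k (Suc n) \<phi> \<longleftrightarrow>
     (\<forall>x. \<phi> differentiable (at x)) \<and> (\<forall>w. C_k n (\<lambda>x. frechet_derivative \<phi> (at x) w))"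

definition test_function_on :: "'a::euclidean_space set \<Rightarrow> ('a \<Rightarrow> real) \<Rightarrow> bool" where
  "test_function_on U \<phi> \<longleftrightarrow>
     (\<forall>n. C_k n \<phi>) \<and> compact (closure {x. \<phi> x \<noteq> 0}) \<and> closure {x. \<phi> x \<noteq> 0} \<subseteq> U"

definition distribution_of :: "('a::euclidean_space \<Rightarrow> real) \<Rightarrow> ('a \<Rightarrow> real) \<Rightarrow> real" where
  "distribution_of g \<phi> = (LINT x|lborel. g x * \<phi> x)"

definition distribution_vanishes_on :: "('a::euclidean_space \<Rightarrow> real) \<Rightarrow> 'a set \<Rightarrow> bool" where
  "distribution_vanishes_on g U \<longleftrightarrow> (\<forall>\<phi>. test_function_on U \<phi> \<longrightarrow> distribution_of g \<phi> = 0)"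

text \<open>The largest open set on which the distribution vanishes is the union of all such open sets.\<close>

definition dist_supp :: "('a::euclidean_space \<Rightarrow> real) \<Rightarrow> 'a set" where
  "dist_supp g = - \<Union>{U. open U \<and> distribution_vanishes_on g U}"

subsection \<open>The kernel\<close>

text \<open>Having a radius \<open>R\<close> of the support means that the support is the closed ball of radius \<open>R\<close>.
  For a support that is merely contained in that ball (an annulus, say) there would be points close
  to a small initial support that the diffusion does not reach.\<close>

definition stefan_kernel :: "('a::euclidean_space \<Rightarrow> real) \<Rightarrow> real \<Rightarrow> bool" where
  "stefan_kernel J R \<longleftrightarrow>
     continuous_on UNIV J \<and> (\<forall>x. 0 \<le> J x) \<and>
     compact (closure {x. J x \<noteq> 0}) \<and> closure {x. J x \<noteq> 0} = cball 0 R \<and>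
     (\<forall>x y. norm x = norm y \<longrightarrow> J x = J y) \<and>
     integrable lborel J \<and> (LINT x|lborel. J x) = 1"

definition space_conv :: "('a::euclidean_space \<Rightarrow> real) \<Rightarrow> ('a \<Rightarrow> real) \<Rightarrow> 'a \<Rightarrow> real" where
  "space_conv J g x = (LINT y|lborel. J (x - y) * g y)"

subsection \<open>L1-valued functions of time and the L1-solution\<close>

text \<open>Elements of \<open>L\<^sup>1\<close> are represented by integrable functions; everything below depends only on the
  almost-everywhere classes of the values \<open>u t\<close>, and no joint measurability in \<open>(t, x)\<close> of the
  chosen representatives is required.\<close>

definition L1_norm :: "('a::euclidean_space \<Rightarrow> real) \<Rightarrow> real" where
  "L1_norm g = (LINT x|lborel. \<bar>g x\<bar>)"

definition Linf_norm :: "('a::euclidean_space \<Rightarrow> real) \<Rightarrow> real" where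
  "Linf_norm g = real_of_ereal (esssup lborel (\<lambda>x. ereal \<bar>g x\<bar>))"

definition L1_continuous :: "(real \<Rightarrow> 'a::euclidean_space \<Rightarrow> real) \<Rightarrow> bool" where
  "L1_continuous u \<longleftrightarrow>
     (\<forall>t\<ge>0. integrable lborel (u t)) \<and>
     (\<forall>t\<ge>0. ((\<lambda>s. L1_norm (\<lambda>x. u s x - u t x)) \<longlongrightarrow> 0) (at t within {0..}))"

text \<open>The time integral of an \<open>L\<^sup>1\<close>-valued function: this is \<open>has_integral\<close> (on an interval) with the
  norm of \<open>L\<^sup>1\<close> in place of that of a normed vector space type. For a continuous integrand, which is
  the case for the \<open>L\<^sup>1\<close>-solution, it is the Riemann integral and the Bochner integral.\<close>

definition has_L1_integral ::
  "(real \<Rightarrow> 'a::euclidean_space \<Rightarrow> real) \<Rightarrow> ('a \<Rightarrow> real) \<Rightarrow> real \<Rightarrow> real \<Rightarrow> bool" where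
  "has_L1_integral F I a b \<longleftrightarrow>
     (\<forall>s\<in>{a..b}. integrable lborel (F s)) \<and> integrable lborel I \<and>
     (\<forall>e>0. \<exists>\<gamma>. gauge \<gamma> \<and>
        (\<forall>\<D>. \<D> tagged_division_of {a..b} \<and> \<gamma> fine \<D> \<longrightarrow>
           L1_norm (\<lambda>x. (\<Sum>(s, K)\<in>\<D>. measure lborel K * F s x) - I x) < e))"

definition temperature :: "(real \<Rightarrow> 'a \<Rightarrow> real) \<Rightarrow> real \<Rightarrow> 'a \<Rightarrow> real" where
  "temperature u t x = max (u t x - 1) 0"

definition L1_solution ::
  "('a::euclidean_space \<Rightarrow> real) \<Rightarrow> ('a \<Rightarrow> real) \<Rightarrow> (real \<Rightarrow> 'a \<Rightarrow> real) \<Rightarrow> bool" where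
  "L1_solution J f u \<longleftrightarrow>
     L1_continuous u \<and>
     (\<forall>t>0. has_L1_integral
        (\<lambda>s x. space_conv J (temperature u s) x - temperature u s x)
        (\<lambda>x. u t x - f x) 0 t)"

definition mushy_region :: "(real \<Rightarrow> 'a::euclidean_space \<Rightarrow> real) \<Rightarrow> real \<Rightarrow> 'a set" where
  "mushy_region u t = interior (dist_supp (u t) - dist_supp (temperature u t))"

subsection \<open>Points at distance exactly R\<close>

text \<open>The distance to \<open>S\<close> has no local maximum with value \<open>R\<close>. At such a point \<open>x\<close> (for instance the
  origin for \<open>S = [-2R, -R] \<union> [R, 2R]\<close> on the line, with \<open>f = 2\<close> on \<open>S\<close> and \<open>f = 0\<close> elsewhere)
  all nearby points are at distance at most \<open>R\<close>, those at distance strictly between \<open>0\<close> and \<open>R\<close>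
  accumulate at \<open>x\<close>, and so \<open>x\<close> is interior to the mushy region although its distance to \<open>S\<close> is \<open>R\<close>.
  The identity of the mushy region with the set of points at distance strictly between \<open>0\<close> and
  \<open>R\<close> therefore holds exactly when there is no such point; in general the mushy region is
  the interior of the set of points at positive distance at most \<open>R\<close>.\<close>

definition no_local_max_of_dist :: "'a::euclidean_space set \<Rightarrow> real \<Rightarrow> bool" where
  "no_local_max_of_dist S R \<longleftrightarrow>
     (\<forall>x. infdist x S = R \<longrightarrow> x \<in> closure {y. R < infdist y S})"

end

theory Submission
  imports Defs
begin

text \<open>
  Write \<open>S\<close> for the support of \<open>f\<close>, \<open>v = (u - 1)\<^sub>+\<close> and \<open>g = (f - 1)\<^sub>+\<close>. The mass of \<open>v\<close> does not increase, so
  \<open>\<partial>\<^sub>t u \<le> J * v \<le> \<parallel>J\<parallel>\<^sub>\<infinity> \<parallel>f\<parallel>\<^sub>1\<close>; as \<open>f = 0\<close> off \<open>S\<close>, this gives \<open>u \<le> 1\<close> and \<open>v = 0\<close> off \<open>S\<close> up to time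
  \<open>t\<^sub>0\<close>. On the other hand \<open>\<partial>\<^sub>t u \<ge> - v\<close> yields \<open>v(t) \<ge> e\<^sup>-\<^sup>t g\<close>. Since \<open>g\<close> has support \<open>S\<close>, so does \<open>v(t)\<close>.
  Off \<open>S\<close> we are left with \<open>u(t) = \<integral>\<^sub>0\<^sup>t J * v(s) ds\<close>, which vanishes at distance more than \<open>R\<^sub>J\<close> from \<open>S\<close> and
  is at least \<open>t e\<^sup>-\<^sup>t J * g\<close>, which is positive on the sum of \<open>{J \<noteq> 0}\<close> and \<open>S\<close>, a dense subset of the set of
  points at distance at most \<open>R\<^sub>J\<close>. A single positive value \<open>J (x - y) > 0\<close> with \<open>y \<in> S\<close> would not do
  for every \<open>x\<close> at distance less than \<open>R\<^sub>J\<close>, because \<open>J\<close> may vanish inside the ball.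
\<close>

subsection \<open>Vanishing of distributions and vanishing almost everywhere\<close>

definition flat :: "nat \<Rightarrow> real \<Rightarrow> real" where
  "flat k s = (if s > 0 then exp (- 1 / s) / s ^ k else 0)"

lemma flat_nonneg: "0 \<le> flat k s"
  by (simp add: flat_def)

lemma flat_0_le_1: "flat 0 s \<le> 1"
  by (simp add: flat_def)

text \<open>The substitution \<open>x = 1 / s\<close> turns the right-hand limit into that of
  \<open>x ^ k / exp x\<close> at infinity; to the left of 0 the function is 0.\<close>

lemma flat_tendsto_0: "(flat k \<longlongrightarrow> 0) (at 0)"
proof -
  have "((\<lambda>x::real. x ^ k / exp x) \<longlongrightarrow> 0) at_top"
    by (rule tendsto_power_div_exp_0)
  then have "((\<lambda>x::real. inverse x ^ k / exp (inverse x)) \<longlongrightarrow> 0) (at_right 0)"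
    by (subst filterlim_at_right_to_top) simp
  moreover have "eventually (\<lambda>x. inverse x ^ k / exp (inverse x) = flat k x) (at_right 0)"
    by (rule eventually_at_rightI[of 0 1]) (auto simp: flat_def exp_minus field_simps)
  ultimately have "(flat k \<longlongrightarrow> 0) (at_right 0)"
    by (rule Lim_transform_eventually)
  moreover have "(flat k \<longlongrightarrow> 0) (at_left 0)"
  proof (rule Lim_transform_eventually[OF tendsto_const])
    show "eventually (\<lambda>x. 0 = flat k x) (at_left 0)"
      by (rule eventually_at_leftI[of "-1"]) (auto simp: flat_def)
  qed
  ultimately show ?thesis
    by (simp add: filterlim_split_at)
qed

text \<open>Differentiating \<open>exp (- 1 / s) / s ^ k\<close> raises the power of
  \<open>1 / s\<close> by two or by one, so the index \<open>k\<close> keeps the family closed under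
  derivatives up to linear combinations.\<close>

lemma flat_has_derivative:
  "(flat k has_real_derivative flat (k + 2) s - real k * flat (k + 1) s) (at s)"
proof -
  consider "s > 0" | "s < 0" | "s = 0" by linarith
  then show ?thesis
  proof cases
    case 1
    have "((\<lambda>s. exp (- 1 / s) / s ^ k) has_real_derivative
            flat (k + 2) s - real k * flat (k + 1) s) (at s)"
    proof -
      \<comment> \<open>For \<open>k = 0\<close> the truncated exponent is off by one, but the
        factor \<open>real k\<close> is then 0.\<close>
      have "real k * s ^ (k - Suc 0) * s = real k * s ^ k"
        by (cases k) auto
      with 1 show ?thesis
        by (auto intro!: derivative_eq_intros simp: flat_def field_simps power2_eq_square)
    qed
    then show ?thesis
      by (rule DERIV_cong_ev[THEN iffD1, rotated -1, OF _ refl _ refl])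
         (use 1 in \<open>auto simp: flat_def eventually_nhds intro!: exI[of _ "{0<..}"]\<close>)
  next
    case 2
    have "((\<lambda>s. 0) has_real_derivative flat (k + 2) s - real k * flat (k + 1) s) (at s)"
      using 2 by (auto simp: flat_def)
    then show ?thesis
      by (rule DERIV_cong_ev[THEN iffD1, rotated -1, OF _ refl _ refl])
         (use 2 in \<open>auto simp: flat_def eventually_nhds intro!: exI[of _ "{..<0}"]\<close>)
  next
    case 3
    \<comment> \<open>The difference quotient at 0 is the next member of the family, which tends to
      0.\<close>
    have "(\<lambda>h. flat k h / h) = flat (Suc k)"
      by (auto simp: flat_def fun_eq_iff)
    then show ?thesis
      using 3 flat_tendsto_0[of "Suc k"] by (auto simp: DERIV_def flat_def)
  qed
qed

section \<open>An algebra of functions closed under directional derivatives\<close>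

inductive bump_algebra :: "('a::euclidean_space \<Rightarrow> real) \<Rightarrow> bool" where
  const: "bump_algebra (\<lambda>x. c)"
| flat: "bump_algebra (\<lambda>x. flat k (x \<bullet> w + d))"
| add: "bump_algebra \<phi> \<Longrightarrow> bump_algebra \<psi> \<Longrightarrow> bump_algebra (\<lambda>x. \<phi> x + \<psi> x)"
| mult: "bump_algebra \<phi> \<Longrightarrow> bump_algebra \<psi> \<Longrightarrow> bump_algebra (\<lambda>x. \<phi> x * \<psi> x)"

text \<open>For the generators the chain rule contributes only the constant factor
  \<open>v \<bullet> w\<close>; sums and products follow by linearity and the Leibniz rule. This
  closure lets \<open>C_k\<close> be proved by induction on the order.\<close>

lemma bump_algebra_derivative:
  "bump_algebra \<phi> \<Longrightarrow>
    \<exists>\<phi>'. (\<forall>x. (\<phi> has_derivative \<phi>' x) (at x)) \<and> (\<forall>w. bump_algebra (\<lambda>x. \<phi>' x w))"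
proof (induction rule: bump_algebra.induct)
  case (const c)
  show ?case
    by (rule exI[of _ "\<lambda>x w. 0"]) (auto intro: bump_algebra.const)
next
  case (flat k w d)
  let ?g = "\<lambda>x. flat (k + 2) (x \<bullet> w + d) + (- real k) * flat (k + 1) (x \<bullet> w + d)"
  have "((\<lambda>x. flat k (x \<bullet> w + d)) has_derivative (\<lambda>v. ?g x * (v \<bullet> w))) (at x)" for x
  proof -
    have "((\<lambda>x. x \<bullet> w + d) has_derivative (\<lambda>v. v \<bullet> w)) (at x)"
      by (auto intro!: derivative_eq_intros)
    from DERIV_compose_FDERIV[OF flat_has_derivative this]
    show ?thesis by (simp add: mult.commute)
  qed
  moreover have "bump_algebra (\<lambda>x. ?g x * (v \<bullet> w))" for v
    by (intro bump_algebra.intros)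
  ultimately show ?case
    by (intro exI[of _ "\<lambda>x v. ?g x * (v \<bullet> w)"] conjI allI)
next
  case (add \<phi> \<psi>)
  then obtain \<phi>' \<psi>' where
    "\<forall>x. (\<phi> has_derivative \<phi>' x) (at x)" "\<forall>w. bump_algebra (\<lambda>x. \<phi>' x w)"
    "\<forall>x. (\<psi> has_derivative \<psi>' x) (at x)" "\<forall>w. bump_algebra (\<lambda>x. \<psi>' x w)"
    by blast
  then show ?case
    by (intro exI[of _ "\<lambda>x v. \<phi>' x v + \<psi>' x v"] conjI allI)
       (auto intro: has_derivative_add bump_algebra.add)
next
  case (mult \<phi> \<psi>)
  then obtain \<phi>' \<psi>' where
    "\<forall>x. (\<phi> has_derivative \<phi>' x) (at x)" "\<forall>w. bump_algebra (\<lambda>x. \<phi>' x w)"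
    "\<forall>x. (\<psi> has_derivative \<psi>' x) (at x)" "\<forall>w. bump_algebra (\<lambda>x. \<psi>' x w)"
    by blast
  with mult.hyps show ?case
    by (intro exI[of _ "\<lambda>x v. \<phi> x * \<psi>' x v + \<phi>' x v * \<psi> x"] conjI allI)
       (auto intro!: has_derivative_mult bump_algebra.add bump_algebra.mult)
qed

lemma bump_algebra_C_k: "bump_algebra \<phi> \<Longrightarrow> C_k n \<phi>"
proof (induction n arbitrary: \<phi>)
  case 0
  from bump_algebra_derivative[OF this] show ?case
    by (auto simp: continuous_on_eq_continuous_at intro: has_derivative_continuous)
next
  case (Suc n)
  from bump_algebra_derivative[OF Suc.prems] obtain \<phi>' where
    \<phi>': "\<And>x. (\<phi> has_derivative \<phi>' x) (at x)" "\<And>w. bump_algebra (\<lambda>x. \<phi>' x w)"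
    by blast
  have "frechet_derivative \<phi> (at x) = \<phi>' x" for x
    using frechet_derivative_at[OF \<phi>'(1)] by simp
  then show ?case
    using \<phi>' Suc.IH by (auto intro: differentiableI)
qed

lemma bump_algebra_prod:
  "finite I \<Longrightarrow> (\<And>i. i \<in> I \<Longrightarrow> bump_algebra (\<phi> i)) \<Longrightarrow> bump_algebra (\<lambda>x. \<Prod>i\<in>I. \<phi> i x)"
  by (induction I rule: finite_induct) (auto intro: bump_algebra.intros)

text \<open>The \<open>n\<close>-th function is the \<open>n\<close>-th root of the first one, because
  \<open>flat 0 (n s) = (flat 0 s)\<^sup>1\<^sup>/\<^sup>n\<close>; hence the sequence converges to the indicator of the box.\<close>

definition box_bump :: "'a::euclidean_space \<Rightarrow> 'a \<Rightarrow> nat \<Rightarrow> 'a \<Rightarrow> real" where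
  "box_bump a b n x =
     (\<Prod>i\<in>Basis. flat 0 (real n * (x \<bullet> i - a \<bullet> i)) * flat 0 (real n * (b \<bullet> i - x \<bullet> i)))"

lemma box_bump_nonneg: "0 \<le> box_bump a b n x"
  by (auto simp: box_bump_def intro!: prod_nonneg mult_nonneg_nonneg flat_nonneg)

lemma box_bump_le_1: "box_bump a b n x \<le> 1"
  unfolding box_bump_def
  by (intro prod_le_1 conjI mult_nonneg_nonneg mult_le_one flat_nonneg flat_0_le_1)

lemma box_bump_eq_0: "x \<notin> box a b \<Longrightarrow> box_bump a b n x = 0"
proof -
  assume "x \<notin> box a b"
  then obtain i where i: "i \<in> Basis" "x \<bullet> i \<le> a \<bullet> i \<or> b \<bullet> i \<le> x \<bullet> i"
    by (auto simp: mem_box not_less)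
  then have "flat 0 (real n * (x \<bullet> i - a \<bullet> i)) = 0 \<or> flat 0 (real n * (b \<bullet> i - x \<bullet> i)) = 0"
    by (auto simp: flat_def zero_less_mult_iff)
  then show ?thesis
    using i(1) by (auto simp: box_bump_def)
qed

lemma box_bump_test_function:
  assumes "cbox a b \<subseteq> U"
  shows "test_function_on U (box_bump a b n)"
proof -
  have "bump_algebra (\<lambda>x. flat 0 (real n * (x \<bullet> i - a \<bullet> i)) * flat 0 (real n * (b \<bullet> i - x \<bullet> i)))" for i
    using bump_algebra.mult[OF bump_algebra.flat[of 0 "real n *\<^sub>R i" "- (real n * (a \<bullet> i))"]
        bump_algebra.flat[of 0 "- real n *\<^sub>R i" "real n * (b \<bullet> i)"]]
    by (simp add: algebra_simps)
  then have "bump_algebra (box_bump a b n)"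
    unfolding box_bump_def by (intro bump_algebra_prod) auto
  moreover have sub: "closure {x. box_bump a b n x \<noteq> 0} \<subseteq> cbox a b"
    by (intro closure_minimal) (use box_bump_eq_0 box_subset_cbox in \<open>auto, blast\<close>)
  moreover have "compact (closure {x. box_bump a b n x \<noteq> 0})"
    using compact_Int_closed[OF compact_cbox closed_closure, of a b "{x. box_bump a b n x \<noteq> 0}"] sub
    by (simp add: Int_absorb1)
  ultimately show ?thesis
    using assms by (auto simp: test_function_on_def bump_algebra_C_k)
qed

lemma flat_0_tendsto_1:
  assumes "s > 0"
  shows "(\<lambda>n. flat 0 (real n * s)) \<longlonglongrightarrow> 1"
proof -
  have "(\<lambda>n. exp (- (1 / s) * (1 / real n))) \<longlonglongrightarrow> exp (- (1 / s) * 0)"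
    by (intro tendsto_intros lim_1_over_n)
  then have "(\<lambda>n. exp (- (1 / s) * (1 / real n))) \<longlonglongrightarrow> 1"
    by simp
  \<comment> \<open>Only eventually: at \<open>n = 0\<close> the left side is 1, because
    \<open>1 / 0 = 0\<close>, and the right side is 0.\<close>
  moreover have "eventually (\<lambda>n. exp (- (1 / s) * (1 / real n)) = flat 0 (real n * s)) sequentially"
    using eventually_gt_at_top[of 0]
    by eventually_elim (use assms in \<open>auto simp: flat_def\<close>)
  ultimately show ?thesis
    by (rule Lim_transform_eventually)
qed

lemma box_bump_tendsto:
  fixes a b x :: "'a::euclidean_space"
  shows "(\<lambda>n. box_bump a b n x) \<longlonglongrightarrow> indicator (box a b) x"
proof (cases "x \<in> box a b")
  case True
  have "(\<lambda>n. box_bump a b n x) \<longlonglongrightarrow> (\<Prod>i\<in>(Basis :: 'a set). 1 * 1)"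
    unfolding box_bump_def
    by (intro tendsto_prod tendsto_mult flat_0_tendsto_1) (use True in \<open>auto simp: mem_box\<close>)
  with True show ?thesis by simp
qed (simp add: box_bump_eq_0)

lemma box_bump_measurable [measurable]: "box_bump a b n \<in> borel_measurable borel"
  using box_bump_test_function[of a b UNIV n]
  by (auto simp: test_function_on_def intro!: borel_measurable_continuous_onI dest!: spec[of _ 0])

text \<open>Dominated convergence along the box bumps, with majorant \<open>\<bar>g x\<bar>\<close>,
  passes from test functions to the indicator of an open box.\<close>

lemma vanishes_imp_box_integral_0:
  fixes g :: "'a::euclidean_space \<Rightarrow> real"
  assumes g: "integrable lborel g" and van: "distribution_vanishes_on g U" and sub: "cbox a b \<subseteq> U"
  shows "(LINT x|lborel. g x * indicator (box a b) x) = 0"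
proof -
  have gm [measurable]: "g \<in> borel_measurable borel" using g by auto
  have "(\<lambda>n. LINT x|lborel. g x * box_bump a b n x) \<longlonglongrightarrow> (LINT x|lborel. g x * indicator (box a b) x)"
  proof (rule integral_dominated_convergence[where w = "\<lambda>x. \<bar>g x\<bar>"])
    show "AE x in lborel. (\<lambda>n. g x * box_bump a b n x) \<longlonglongrightarrow> g x * indicator (box a b) x"
      by (auto intro!: tendsto_intros box_bump_tendsto)
    show "AE x in lborel. norm (g x * box_bump a b n x) \<le> \<bar>g x\<bar>" for n
      using box_bump_nonneg[of a b n] box_bump_le_1[of a b n]
      by (intro AE_I2) (auto simp: abs_mult abs_of_nonneg intro!: mult_left_le)
  qed (use g in auto)
  moreover have "(LINT x|lborel. g x * box_bump a b n x) = 0" for n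
    using van box_bump_test_function[OF sub]
    by (auto simp: distribution_vanishes_on_def distribution_of_def)
  ultimately show ?thesis
    by (simp add: LIMSEQ_const_iff)
qed

text \<open>Open boxes form an intersection-stable generator of the Borel sets, so a Dynkin argument
  gives integral 0 over every Borel set, and uniqueness of densities applies.\<close>

lemma AE_0_if_box_integrals_0:
  fixes h :: "'a::euclidean_space \<Rightarrow> real"
  assumes h: "integrable lborel h"
    and box: "\<And>a b. (LINT x|lborel. h x * indicator (box a b) x) = 0"
  shows "AE x in lborel. h x = 0"
proof -
  have hm [measurable]: "h \<in> borel_measurable borel" using h by auto
  have int: "integrable lborel (\<lambda>x. h x * indicator A x)" if "A \<in> sets borel" for A
    using integrable_mult_indicator[OF _ h, of A] that by (simp add: mult.commute)
  let ?E = "range (\<lambda>(a, b). box a b :: 'a set)"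
  \<comment> \<open>The complement step of the induction needs the integral over the whole space,
    obtained by exhaustion with growing boxes.\<close>
  have all: "(LINT x|lborel. h x) = 0"
  proof -
    have "(\<lambda>n. LINT x|lborel. h x * indicator (box (- real n *\<^sub>R One) (real n *\<^sub>R One)) x)
        \<longlonglongrightarrow> (LINT x|lborel. h x)"
    proof (rule integral_dominated_convergence[where w = "\<lambda>x. \<bar>h x\<bar>"])
      show "AE x in lborel. (\<lambda>n. h x * indicator (box (- real n *\<^sub>R One) (real n *\<^sub>R One)) x) \<longlonglongrightarrow> h x"
      proof (rule AE_I2)
        fix x :: 'a
        obtain m :: nat where m: "norm x < real m" using reals_Archimedean2 by blast
        have "x \<in> box (- real n *\<^sub>R One) (real n *\<^sub>R One)" if "n \<ge> m" for n
        proof -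
          have "\<bar>x \<bullet> i\<bar> < real n" if "i \<in> Basis" for i
            using Basis_le_norm[OF that, of x] m \<open>n \<ge> m\<close> by linarith
          then show ?thesis by (force simp: mem_box abs_less_iff)
        qed
        then have "eventually (\<lambda>n. h x = h x * indicator (box (- real n *\<^sub>R One) (real n *\<^sub>R One)) x) sequentially"
          by (intro eventually_sequentiallyI[of m]) (simp add: indicator_def)
        then show "(\<lambda>n. h x * indicator (box (- real n *\<^sub>R One) (real n *\<^sub>R One)) x) \<longlonglongrightarrow> h x"
          by (rule Lim_transform_eventually[OF tendsto_const])
      qed
    qed (use h in \<open>auto simp: indicator_def\<close>)
    then show ?thesis
      by (simp add: box LIMSEQ_const_iff)
  qed
  have "(LINT x|lborel. h x * indicator A x) = 0" if "A \<in> sigma_sets UNIV ?E" for A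
  proof (induction rule: sigma_sets_induct_disjoint[OF _ _ that])
    show "Int_stable ?E"
      by (force simp: Int_stable_def box_Int_box)
  next
    case (3 A)
    then show ?case using box by auto
  next
    case 4
    show ?case by simp
  next
    case (5 A)
    then have "A \<in> sets borel" by (simp add: borel_eq_box)
    then have "(LINT x|lborel. h x * indicator (UNIV - A) x)
        = (LINT x|lborel. h x) - (LINT x|lborel. h x * indicator A x)"
      by (subst Bochner_Integration.integral_diff[symmetric, OF h int])
         (auto intro!: Bochner_Integration.integral_cong simp: indicator_def)
    then show ?case using 5 all by simp
  next
    case (6 A)
    then have A: "A i \<in> sets borel" for i by (auto simp: borel_eq_box)
    have "(LINT x:(\<Union>i. A i)|lborel. h x) = (\<Sum>i. LINT x:A i|lborel. h x)"
      using 6 A int[of "\<Union>i. A i"]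
      by (intro lebesgue_integral_countable_add)
         (auto simp: disjoint_family_on_def set_integrable_def mult.commute)
    then show ?case
      using 6 by (simp add: set_lebesgue_integral_def mult.commute)
  qed auto
  then have "(LINT x:A|lborel. h x) = (LINT x:A|lborel. 0)" if "A \<in> sets lborel" for A
    using that by (simp add: borel_eq_box set_lebesgue_integral_def mult.commute)
  then show ?thesis
    by (intro density_unique_real) (use h in auto)
qed

text \<open>For the direct implication, \<open>U\<close> is a countable union of closed boxes; on
  each of them \<open>g\<close> is cut off by the indicator of the box and all box integrals of the
  product vanish.\<close>

lemma vanishes_on_iff_AE:
  fixes g :: "'a::euclidean_space \<Rightarrow> real"
  assumes g: "integrable lborel g" and U: "open U"
  shows "distribution_vanishes_on g U \<longleftrightarrow> (AE x in lborel. x \<in> U \<longrightarrow> g x = 0)"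
proof
  assume van: "distribution_vanishes_on g U"
  obtain \<D> where \<D>: "countable \<D>" "\<D> \<subseteq> Pow U" "\<And>X. X \<in> \<D> \<Longrightarrow> \<exists>a b. X = cbox a b" "\<Union>\<D> = U"
    using open_countable_Union_open_cbox[OF U] by metis
  have "AE x in lborel. x \<in> X \<longrightarrow> g x = 0" if X: "X \<in> \<D>" for X
  proof -
    obtain c d where cd: "X = cbox c d" "cbox c d \<subseteq> U" using \<D>(2,3) X by blast
    have "AE x in lborel. g x * indicator (box c d) x = 0"
    proof (rule AE_0_if_box_integrals_0)
      show "integrable lborel (\<lambda>x. g x * indicator (box c d) x)"
        using integrable_mult_indicator[OF _ g, of "box c d"] by (simp add: mult.commute)
      fix a b
      \<comment> \<open>Two boxes meet in a box, whose closed version stays inside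
        \<open>U\<close>.\<close>
      obtain p q where pq: "box c d \<inter> box a b = box p q" "cbox p q \<subseteq> cbox c d"
        by (auto simp: box_Int_box subset_box(1) intro!: that)
      have "g x * indicator (box c d) x * indicator (box a b) x = g x * indicator (box p q) x" for x
        using pq(1) by (auto simp: indicator_def)
      then show "(LINT x|lborel. g x * indicator (box c d) x * indicator (box a b) x) = 0"
        using vanishes_imp_box_integral_0[OF g van, of p q] pq cd by (simp only: subset_trans)
    qed
    \<comment> \<open>The boundary of a box is a null set, so the open box suffices.\<close>
    moreover have "AE x in lborel. x \<notin> cbox c d - box c d"
      by (intro AE_not_in) (simp add: null_sets_def emeasure_lborel_cbox_eq emeasure_lborel_box_eq emeasure_Diff box_subset_cbox)
    ultimately show ?thesis
      by eventually_elim (auto simp: cd)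
  qed
  then have "AE x in lborel. \<forall>X\<in>\<D>. x \<in> X \<longrightarrow> g x = 0"
    using \<D>(1) by (subst AE_ball_countable) auto
  then show "AE x in lborel. x \<in> U \<longrightarrow> g x = 0"
    by eventually_elim (use \<D>(4) in auto)
next
  assume *: "AE x in lborel. x \<in> U \<longrightarrow> g x = 0"
  show "distribution_vanishes_on g U"
    unfolding distribution_vanishes_on_def distribution_of_def
  proof (intro allI impI)
    fix \<phi> assume "test_function_on U \<phi>"
    then have "\<phi> x = 0" if "x \<notin> U" for x
      using that closure_subset[of "{x. \<phi> x \<noteq> 0}"] by (auto simp: test_function_on_def)
    with * have "AE x in lborel. g x * \<phi> x = 0"
      by (auto elim!: eventually_mono)
    then show "(LINT x|lborel. g x * \<phi> x) = 0"
      by (rule integral_eq_zero_AE)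
  qed
qed

section \<open>Distributional supports in terms of null sets\<close>

lemma not_in_dist_supp_iff:
  assumes "integrable lborel g"
  shows "x \<notin> dist_supp g \<longleftrightarrow> (\<exists>U. open U \<and> x \<in> U \<and> (AE y in lborel. y \<in> U \<longrightarrow> g y = 0))"
  using vanishes_on_iff_AE[OF assms] by (auto simp: dist_supp_def)

lemma closed_dist_supp: "closed (dist_supp g)"
  by (auto simp: dist_supp_def closed_def)

text \<open>The union in \<open>dist_supp\<close> may be uncountable; the Lindelof property extracts
  a countable subfamily with the same union, hence only countably many null sets.\<close>

lemma AE_eq_0_off_dist_supp:
  fixes g :: "'a::euclidean_space \<Rightarrow> real"
  assumes g: "integrable lborel g"
  shows "AE x in lborel. x \<notin> dist_supp g \<longrightarrow> g x = 0"
proof -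
  let ?F = "{U. open U \<and> distribution_vanishes_on g U}"
  obtain \<D> where \<D>: "\<D> \<subseteq> ?F" "countable \<D>" "\<Union>\<D> = \<Union>?F"
    using Lindelof[of ?F] by auto
  have "AE x in lborel. \<forall>X\<in>\<D>. x \<in> X \<longrightarrow> g x = 0"
    using \<D>(1,2) vanishes_on_iff_AE[OF g] by (subst AE_ball_countable) auto
  then show ?thesis
    by eventually_elim (use \<D>(3) in \<open>auto simp: dist_supp_def\<close>)
qed

subsection \<open>Time integrals with values in L1\<close>

lemma L1_norm_nonneg: "0 \<le> L1_norm g"
  by (simp add: L1_norm_def)

text \<open>The pointwise hypothesis lets one rule serve sums and differences in any arrangement of
  the terms.\<close>

lemma L1_norm_triangle:
  assumes "integrable lborel g" "integrable lborel h"
    and "\<And>x. \<bar>k x\<bar> \<le> \<bar>g x\<bar> + \<bar>h x\<bar>"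
  shows "L1_norm k \<le> L1_norm g + L1_norm h"
proof -
  have "L1_norm k \<le> (LINT x|lborel. \<bar>g x\<bar> + \<bar>h x\<bar>)"
    unfolding L1_norm_def using assms by (intro integral_mono') auto
  then show ?thesis
    using assms(1,2) by (simp add: L1_norm_def)
qed

lemma L1_norm_sum_le:
  assumes "finite I" "\<And>i. i \<in> I \<Longrightarrow> integrable lborel (g i)"
  shows "L1_norm (\<lambda>x. \<Sum>i\<in>I. c i * g i x) \<le> (\<Sum>i\<in>I. \<bar>c i\<bar> * L1_norm (g i))"
proof -
  have "L1_norm (\<lambda>x. \<Sum>i\<in>I. c i * g i x) \<le> (LINT x|lborel. (\<Sum>i\<in>I. \<bar>c i\<bar> * \<bar>g i x\<bar>))"
    unfolding L1_norm_def
  proof (rule integral_mono')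
    show "\<bar>\<Sum>i\<in>I. c i * g i x\<bar> \<le> (\<Sum>i\<in>I. \<bar>c i\<bar> * \<bar>g i x\<bar>)" for x
      by (rule order_trans[OF sum_abs]) (simp add: abs_mult)
  qed (use assms in \<open>auto intro!: sum_nonneg\<close>)
  also have "\<dots> = (\<Sum>i\<in>I. \<bar>c i\<bar> * L1_norm (g i))"
    using assms by (subst Bochner_Integration.integral_sum) (auto simp: L1_norm_def)
  finally show ?thesis .
qed

lemma L1_norm_scale: "L1_norm (\<lambda>x. c * g x) = \<bar>c\<bar> * L1_norm g"
  by (simp add: L1_norm_def abs_mult)

section \<open>Riemann sums, increments and comparison of integrals\<close>

definition riemann_sum ::
  "(real \<Rightarrow> 'a \<Rightarrow> real) \<Rightarrow> (real \<times> real set) set \<Rightarrow> 'a \<Rightarrow> real" where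
  "riemann_sum F \<D> x = (\<Sum>(s, K)\<in>\<D>. measure lborel K * F s x)"

lemma integrable_riemann_sum:
  assumes "\<D> tagged_division_of {a..b}" "\<And>s. s \<in> {a..b} \<Longrightarrow> integrable lborel (F s)"
  shows "integrable lborel (riemann_sum F \<D>)"
proof -
  have "fst p \<in> {a..b}" if "p \<in> \<D>" for p
    using tag_in_interval[OF assms(1), of "fst p" "snd p"] that by auto
  then show ?thesis
    unfolding riemann_sum_def split_beta using assms(2)
    by (intro Bochner_Integration.integrable_sum integrable_mult_right) auto
qed

lemma has_L1_integralD:
  assumes "has_L1_integral F I a b" "e > 0"
  obtains \<gamma> where "gauge \<gamma>"
    "\<And>\<D>. \<D> tagged_division_of {a..b} \<Longrightarrow> \<gamma> fine \<D> \<Longrightarrow> L1_norm (\<lambda>x. riemann_sum F \<D> x - I x) < e"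
proof -
  have "\<exists>\<gamma>. gauge \<gamma> \<and> (\<forall>\<D>. \<D> tagged_division_of {a..b} \<and> \<gamma> fine \<D> \<longrightarrow>
      L1_norm (\<lambda>x. riemann_sum F \<D> x - I x) < e)"
    using assms unfolding has_L1_integral_def riemann_sum_def
    by (elim conjE) (erule allE, erule mp)
  then show ?thesis
    by (elim exE conjE) (rule that, assumption, rule mp, erule spec, rule conjI)
qed

text \<open>Divisions of \<open>{c..a}\<close> and \<open>{a..b}\<close> that are fine for both
  gauges glue to a fine division of \<open>{c..b}\<close>; subtracting the two Riemann sums leaves
  the one over \<open>{a..b}\<close>.\<close>

lemma has_L1_integral_increment:
  assumes b: "has_L1_integral F Ib c b" and a: "has_L1_integral F Ia c a"
    and ord: "c \<le> a" "a \<le> b" and e: "e > 0"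
  obtains \<D> where "\<D> tagged_division_of {a..b}"
    "L1_norm (\<lambda>x. riemann_sum F \<D> x - (Ib x - Ia x)) < e"
proof -
  have F: "integrable lborel (F s)" if "s \<in> {c..b}" for s
    using b that by (auto simp: has_L1_integral_def)
  have I: "integrable lborel Ib" "integrable lborel Ia"
    using a b by (auto simp: has_L1_integral_def)
  obtain \<gamma>b where \<gamma>b: "gauge \<gamma>b" "\<And>\<D>. \<D> tagged_division_of {c..b} \<Longrightarrow> \<gamma>b fine \<D> \<Longrightarrow>
      L1_norm (\<lambda>x. riemann_sum F \<D> x - Ib x) < e / 2"
    using has_L1_integralD[OF b half_gt_zero[OF e]] by blast
  obtain \<gamma>a where \<gamma>a: "gauge \<gamma>a" "\<And>\<D>. \<D> tagged_division_of {c..a} \<Longrightarrow> \<gamma>a fine \<D> \<Longrightarrow>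
      L1_norm (\<lambda>x. riemann_sum F \<D> x - Ia x) < e / 2"
    using has_L1_integralD[OF a half_gt_zero[OF e]] by blast
  have \<gamma>: "gauge (\<lambda>x. \<gamma>a x \<inter> \<gamma>b x)"
    using \<gamma>a(1) \<gamma>b(1) by (rule gauge_Int)
  obtain \<D>1 where D1: "\<D>1 tagged_division_of {c..a}" "(\<lambda>x. \<gamma>a x \<inter> \<gamma>b x) fine \<D>1"
    using fine_division_exists_real[OF \<gamma>] by blast
  obtain \<D>2 where D2: "\<D>2 tagged_division_of {a..b}" "(\<lambda>x. \<gamma>a x \<inter> \<gamma>b x) fine \<D>2"
    using fine_division_exists_real[OF \<gamma>] by blast
  have "\<D>1 \<union> \<D>2 tagged_division_of {c..a} \<union> {a..b}"
    using D1 D2 by (intro tagged_division_Un) (auto simp: interior_atLeastAtMost_real)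
  then have D: "\<D>1 \<union> \<D>2 tagged_division_of {c..b}"
    using ord by (simp add: ivl_disj_un_two_touch)
  have sum: "riemann_sum F (\<D>1 \<union> \<D>2) x = riemann_sum F \<D>1 x + riemann_sum F \<D>2 x" for x
    unfolding riemann_sum_def
  proof (rule sum.union_inter_neutral)
    show "\<forall>y\<in>\<D>1 \<inter> \<D>2. (case y of (s, K) \<Rightarrow> measure lborel K * F s x) = 0"
    proof
      fix p assume "p \<in> \<D>1 \<inter> \<D>2"
      then obtain s K where p: "p = (s, K)" and K: "(s, K) \<in> \<D>1" "(s, K) \<in> \<D>2"
        by (cases p) auto
      \<comment> \<open>A pair in both divisions has an interval of length 0, so nothing is counted
        twice.\<close>
      have "K \<subseteq> {a}"
        using tagged_division_ofD(3)[OF D1(1) K(1)] tagged_division_ofD(3)[OF D2(1) K(2)] by fastforce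
      then have "K = {} \<or> K = {a}" by auto
      then have "measure lborel K = 0" by (auto simp: measure_def)
      then show "(case p of (s, K) \<Rightarrow> measure lborel K * F s x) = 0" by (simp add: p)
    qed
  qed (use D1 D2 in auto)
  have "L1_norm (\<lambda>x. riemann_sum F \<D>2 x - (Ib x - Ia x))
      \<le> L1_norm (\<lambda>x. riemann_sum F (\<D>1 \<union> \<D>2) x - Ib x) + L1_norm (\<lambda>x. riemann_sum F \<D>1 x - Ia x)"
    using integrable_riemann_sum[OF D1(1), of F] integrable_riemann_sum[OF D2(1), of F] F I ord
    by (intro L1_norm_triangle) (auto simp: sum)
  also have "\<dots> < e / 2 + e / 2"
    using D D1 D2 by (intro add_strict_mono \<gamma>a \<gamma>b) (auto simp: fine_Int fine_Un)
  finally have "L1_norm (\<lambda>x. riemann_sum F \<D>2 x - (Ib x - Ia x)) < e" by simp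
  with D2(1) show ?thesis by (rule that)
qed

text \<open>The lengths in a division add up to \<open>b - a\<close>, so an integrand within
  \<open>\<epsilon>\<close> of \<open>G\<close> gives Riemann sums within
  \<open>\<epsilon> * (b - a)\<close> of \<open>(b - a) * G\<close>. This yields the first-order
  expansion of a solution in time.\<close>

lemma has_L1_integral_increment_approx:
  assumes b: "has_L1_integral F Ib c b" and a: "has_L1_integral F Ia c a"
    and ord: "c \<le> a" "a \<le> b" and G: "integrable lborel G"
    and close: "\<And>s. s \<in> {a..b} \<Longrightarrow> L1_norm (\<lambda>x. F s x - G x) \<le> \<epsilon>"
  shows "L1_norm (\<lambda>x. Ib x - Ia x - (b - a) * G x) \<le> \<epsilon> * (b - a)"
proof (rule field_le_epsilon)
  fix e :: real assume "e > 0"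
  have F: "integrable lborel (F s)" if "s \<in> {a..b}" for s
    using b that ord by (auto simp: has_L1_integral_def)
  have I: "integrable lborel Ib" "integrable lborel Ia"
    using a b by (auto simp: has_L1_integral_def)
  obtain \<D> where D: "\<D> tagged_division_of {a..b}"
    and le: "L1_norm (\<lambda>x. riemann_sum F \<D> x - (Ib x - Ia x)) < e"
    using has_L1_integral_increment[OF b a ord \<open>e > 0\<close>] by blast
  have fin: "finite \<D>" using D by auto
  have tag: "fst p \<in> {a..b}" if "p \<in> \<D>" for p
    using tag_in_interval[OF D, of "fst p" "snd p"] that by auto
  have content: "(\<Sum>p\<in>\<D>. measure lborel (snd p)) = b - a"
    using additive_content_tagged_division[of \<D> a b] D ord by (simp add: split_beta)
  have diff: "riemann_sum F \<D> x - (b - a) * G x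
      = (\<Sum>p\<in>\<D>. measure lborel (snd p) * (F (fst p) x - G x))" for x
    by (simp add: riemann_sum_def split_beta right_diff_distrib sum_subtractf content
        flip: sum_distrib_right)
  have "L1_norm (\<lambda>x. riemann_sum F \<D> x - (b - a) * G x)
      \<le> (\<Sum>p\<in>\<D>. \<bar>measure lborel (snd p)\<bar> * L1_norm (\<lambda>x. F (fst p) x - G x))"
    unfolding diff using fin F G tag by (intro L1_norm_sum_le) auto
  also have "\<dots> \<le> (\<Sum>p\<in>\<D>. measure lborel (snd p) * \<epsilon>)"
    using close tag by (intro sum_mono) (auto intro!: mult_left_mono)
  also have "\<dots> = \<epsilon> * (b - a)"
    by (simp add: content flip: sum_distrib_right)
  finally have "L1_norm (\<lambda>x. riemann_sum F \<D> x - (b - a) * G x) \<le> \<epsilon> * (b - a)" .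
  moreover have "L1_norm (\<lambda>x. Ib x - Ia x - (b - a) * G x)
      \<le> L1_norm (\<lambda>x. riemann_sum F \<D> x - (b - a) * G x)
        + L1_norm (\<lambda>x. riemann_sum F \<D> x - (Ib x - Ia x))"
    using integrable_riemann_sum[OF D F] I G by (intro L1_norm_triangle) auto
  ultimately show "L1_norm (\<lambda>x. Ib x - Ia x - (b - a) * G x) \<le> \<epsilon> * (b - a) + e"
    using le by linarith
qed

text \<open>Every interval in a division of a point has length 0. This supplies the integral up to
  time 0, whereas \<open>L1_solution\<close> speaks of positive times.\<close>

lemma has_L1_integral_degenerate:
  assumes "integrable lborel (F a)"
  shows "has_L1_integral F (\<lambda>x. 0) a a"
proof -
  have "L1_norm (\<lambda>x. \<Sum>(s, K)\<in>\<D>. measure lborel K * F s x) = 0"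
    if D: "\<D> tagged_division_of {a}" for \<D>
  proof -
    have "(\<Sum>(s, K)\<in>\<D>. measure lborel K * F s x) = 0" for x
    proof (rule sum.neutral, rule ballI)
      fix p assume "p \<in> \<D>"
      then obtain s K where p: "p = (s, K)" and K: "(s, K) \<in> \<D>"
        by (cases p) auto
      have "K \<subseteq> {a}" using tagged_division_ofD(3)[OF D K] .
      then have "K = {} \<or> K = {a}" by auto
      then have "measure lborel K = 0" by (auto simp: measure_def)
      then show "(case p of (s, K) \<Rightarrow> measure lborel K * F s x) = 0" by (simp add: p)
    qed
    then show ?thesis by (simp add: L1_norm_def)
  qed
  with assms show ?thesis
    by (auto simp: has_L1_integral_def gauge_def intro!: exI[of _ "\<lambda>x. UNIV"])
qed

text \<open>The null set in the hypothesis depends on \<open>s\<close>, but a Riemann sum has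
  finitely many tags and so obeys the bound almost everywhere. The excess \<open>h\<close> of
  \<open>I\<close> over the bound then has integral below every positive \<open>e\<close>.\<close>

lemma has_L1_integral_AE_le:
  fixes F :: "real \<Rightarrow> 'a::euclidean_space \<Rightarrow> real"
  assumes I: "has_L1_integral F I a b" and "a \<le> b"
    and [measurable]: "G \<in> borel_measurable borel" "A \<in> sets borel"
    and le: "\<And>s. s \<in> {a..b} \<Longrightarrow> AE x in lborel. x \<in> A \<longrightarrow> F s x \<le> G x"
  shows "AE x in lborel. x \<in> A \<longrightarrow> I x \<le> (b - a) * G x"
proof -
  have F: "integrable lborel (F s)" if "s \<in> {a..b}" for s
    using I that by (auto simp: has_L1_integral_def)
  have Iint: "integrable lborel I"
    using I by (auto simp: has_L1_integral_def)
  then have [measurable]: "I \<in> borel_measurable borel" by auto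
  define h where "h x = indicator A x * max (I x - (b - a) * G x) 0" for x
  have hm [measurable]: "h \<in> borel_measurable borel" unfolding h_def by measurable
  have h0: "h x \<ge> 0" for x by (simp add: h_def)
  have key: "integrable lborel h \<and> (LINT x|lborel. h x) < e" if e: "e > 0" for e
  proof -
    obtain \<gamma> where \<gamma>: "gauge \<gamma>" "\<And>\<D>. \<D> tagged_division_of {a..b} \<Longrightarrow> \<gamma> fine \<D> \<Longrightarrow>
        L1_norm (\<lambda>x. riemann_sum F \<D> x - I x) < e"
      using has_L1_integralD[OF I e] by blast
    obtain \<D> where D: "\<D> tagged_division_of {a..b}" "\<gamma> fine \<D>"
      using fine_division_exists_real[OF \<gamma>(1)] by blast
    have tag: "fst p \<in> {a..b}" if "p \<in> \<D>" for p
      using tag_in_interval[OF D(1), of "fst p" "snd p"] that by auto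
    have content: "(\<Sum>p\<in>\<D>. measure lborel (snd p)) = b - a"
      using additive_content_tagged_division[of \<D> a b] D \<open>a \<le> b\<close> by (simp add: split_beta)
    have "AE x in lborel. \<forall>p\<in>\<D>. x \<in> A \<longrightarrow> F (fst p) x \<le> G x"
      using D(1) le tag by (subst AE_ball_countable) (auto intro: countable_finite)
    then have bound: "AE x in lborel. h x \<le> \<bar>riemann_sum F \<D> x - I x\<bar>"
    proof eventually_elim
      case (elim x)
      show ?case
      proof (cases "x \<in> A")
        case True
        have "riemann_sum F \<D> x \<le> (\<Sum>p\<in>\<D>. measure lborel (snd p) * G x)"
          unfolding riemann_sum_def split_beta
          using elim True by (intro sum_mono mult_left_mono) auto
        also have "\<dots> = (b - a) * G x"
          by (simp add: content flip: sum_distrib_right)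
        finally show ?thesis by (auto simp: h_def True)
      qed (simp add: h_def)
    qed
    have int: "integrable lborel (\<lambda>x. \<bar>riemann_sum F \<D> x - I x\<bar>)"
      using integrable_riemann_sum[OF D(1) F] Iint by auto
    \<comment> \<open>\<open>G\<close> is only assumed measurable, which admits constant bounds;
      integrability of \<open>h\<close> comes from its domination by the Riemann sum error.\<close>
    have hint: "integrable lborel h"
      by (rule Bochner_Integration.integrable_bound[OF int]) (use bound h0 in \<open>auto elim!: eventually_mono\<close>)
    have "(LINT x|lborel. h x) \<le> L1_norm (\<lambda>x. riemann_sum F \<D> x - I x)"
      unfolding L1_norm_def by (rule integral_mono_AE[OF hint int bound])
    with hint show ?thesis using \<gamma>(2)[OF D] by simp
  qed
  have "integrable lborel h" using key[of 1] by simp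
  moreover have "(LINT x|lborel. h x) = 0"
  proof (rule antisym)
    show "(LINT x|lborel. h x) \<le> 0"
      by (rule field_le_epsilon) (use key in \<open>auto intro: less_imp_le\<close>)
  qed (simp add: h0)
  ultimately have "AE x in lborel. h x = 0"
    using integral_nonneg_eq_0_iff_AE[of lborel h] h0 by auto
  then show ?thesis
    by eventually_elim (auto simp: h_def)
qed

text \<open>Turns the upper bounds of \<open>has_L1_integral_AE_le\<close> into lower
  bounds.\<close>

lemma has_L1_integral_uminus:
  assumes "has_L1_integral F I a b"
  shows "has_L1_integral (\<lambda>s x. - F s x) (\<lambda>x. - I x) a b"
proof -
  have eq: "L1_norm (\<lambda>x. (\<Sum>(s, K)\<in>\<D>. measure lborel K * - F s x) - - I x)
      = L1_norm (\<lambda>x. (\<Sum>(s, K)\<in>\<D>. measure lborel K * F s x) - I x)" for \<D>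
    unfolding L1_norm_def
    by (intro Bochner_Integration.integral_cong refl)
       (simp add: split_beta sum_negf abs_minus_commute)
  show ?thesis
    using assms unfolding has_L1_integral_def eq by auto
qed

text \<open>A nonempty open set contains a ball of positive measure.\<close>

lemma open_AE_not_in_imp_empty:
  fixes U :: "'a::euclidean_space set"
  assumes "open U" "AE x in lborel. x \<notin> U"
  shows "U = {}"
proof (rule ccontr)
  assume "U \<noteq> {}"
  then obtain x where "x \<in> U" by auto
  then obtain e where e: "e > 0" "ball x e \<subseteq> U"
    using assms(1) open_contains_ball by blast
  have "AE y in lborel. y \<notin> ball x e"
    using assms(2) by eventually_elim (use e in auto)
  then have "emeasure lborel (ball x e) = 0"
    by (subst (asm) AE_iff_measurable[of "ball x e"]) auto
  then have "measure lborel (ball x e) = 0" by (simp add: measure_def)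
  then show False using content_ball_pos[OF e(1), of x] by simp
qed

subsection \<open>Convolution with the kernel\<close>

lemma stefan_kernelD:
  assumes "stefan_kernel J R"
  shows "continuous_on UNIV J" "0 \<le> J x" "compact (closure {x. J x \<noteq> 0})"
    "closure {x. J x \<noteq> 0} = cball 0 R"
    "integrable lborel J" "(LINT x|lborel. J x) = 1"
proof -
  note c = assms[unfolded stefan_kernel_def]
  show "continuous_on UNIV J" by (rule c[THEN conjunct1])
  show "0 \<le> J x" by (rule c[THEN conjunct2, THEN conjunct1, rule_format])
  show "compact (closure {x. J x \<noteq> 0})"
    by (rule c[THEN conjunct2, THEN conjunct2, THEN conjunct1])
  show "closure {x. J x \<noteq> 0} = cball 0 R"
    by (rule c[THEN conjunct2, THEN conjunct2, THEN conjunct2, THEN conjunct1])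
  show "integrable lborel J" "(LINT x|lborel. J x) = 1"
    using c[THEN conjunct2, THEN conjunct2, THEN conjunct2, THEN conjunct2, THEN conjunct2] by simp_all
qed

lemma kernel_bounded:
  assumes "stefan_kernel J R"
  obtains B where "\<And>x. J x \<le> B"
proof -
  have "bounded (J ` closure {x. J x \<noteq> 0})"
    by (intro compact_imp_bounded compact_continuous_image stefan_kernelD(3)[OF assms]
        continuous_on_subset[OF stefan_kernelD(1)[OF assms]]) simp
  then obtain B where B: "\<And>x. x \<in> closure {x. J x \<noteq> 0} \<Longrightarrow> \<bar>J x\<bar> \<le> B"
    by (auto simp: bounded_iff)
  have "J x \<le> max B 0" for x
    using B[of x] closure_subset[of "{x. J x \<noteq> 0}"] by (cases "J x = 0") auto
  then show ?thesis by (rule that)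
qed

text \<open>By continuity the set where \<open>J\<close> exceeds its essential supremum is open;
  being null, it is empty.\<close>

lemma kernel_le_Linf_norm:
  assumes K: "stefan_kernel J R"
  shows "J x \<le> Linf_norm J"
proof -
  obtain B where B: "\<And>x. J x \<le> B" using kernel_bounded[OF K] by blast
  have cont: "continuous_on UNIV J" and nn: "\<And>x. 0 \<le> J x"
    using stefan_kernelD[OF K] by blast+
  then have [measurable]: "J \<in> borel_measurable borel"
    by (intro borel_measurable_continuous_onI)
  \<comment> \<open>Finiteness matters because \<open>real_of_ereal\<close> sends infinity to
    0.\<close>
  have "esssup lborel (\<lambda>x. ereal \<bar>J x\<bar>) \<le> ereal B"
    using B nn by (intro esssup_I) auto
  moreover have "AE x in lborel. ereal \<bar>J x\<bar> \<le> esssup lborel (\<lambda>x. ereal \<bar>J x\<bar>)"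
    by (rule esssup_AE) measurable
  ultimately have "AE x in lborel. x \<notin> {x. Linf_norm J < J x}"
    by (cases "esssup lborel (\<lambda>x. ereal \<bar>J x\<bar>)")
       (auto elim!: eventually_mono simp: Linf_norm_def nn)
  moreover have "open {x. Linf_norm J < J x}"
    using cont by (intro open_Collect_less) auto
  ultimately have "{x. Linf_norm J < J x} = {}"
    using open_AE_not_in_imp_empty by blast
  then show ?thesis by (auto simp: not_less)
qed

lemma lborel_integrable_translate:
  fixes g :: "'a::euclidean_space \<Rightarrow> real"
  assumes "integrable lborel g"
  shows "integrable lborel (\<lambda>x. g (x - y))" "(LINT x|lborel. g (x - y)) = (LINT x|lborel. g x)"
proof -
  have [measurable]: "g \<in> borel_measurable borel" using assms by auto
  have eq: "lborel = distr lborel borel ((+) (- y))"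
    by (simp add: lborel_distr_plus)
  have "integrable (distr lborel borel ((+) (- y))) g"
    using assms eq by simp
  then show "integrable lborel (\<lambda>x. g (x - y))"
    by (subst (asm) integrable_distr_eq) auto
  have "(LINT x|lborel. g x) = (LINT x|distr lborel borel ((+) (- y)). g x)"
    using eq by simp
  then show "(LINT x|lborel. g (x - y)) = (LINT x|lborel. g x)"
    by (subst (asm) integral_distr) auto
qed

context
  fixes J :: "'a::euclidean_space \<Rightarrow> real" and R :: real
  assumes K: "stefan_kernel J R"
begin

lemma kernel_nonneg: "0 \<le> J x"
  using stefan_kernelD(2)[OF K] .

lemma kernel_measurable: "J \<in> borel_measurable borel"
  using stefan_kernelD(1)[OF K] by (rule borel_measurable_continuous_onI)

lemma conv_integrand_integrable:
  assumes "integrable lborel h"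
  shows "integrable lborel (\<lambda>y. J (x - y) * h y)"
proof -
  note [measurable] = kernel_measurable
  obtain B where B: "\<And>x. J x \<le> B" using kernel_bounded[OF K] by blast
  show ?thesis
  proof (rule Bochner_Integration.integrable_bound[of _ "\<lambda>y. B * h y"])
    show "AE y in lborel. norm (J (x - y) * h y) \<le> norm (B * h y)"
      using B kernel_nonneg order_trans[OF kernel_nonneg B]
      by (auto simp: abs_mult abs_of_nonneg intro!: mult_right_mono)
  qed (use assms in auto)
qed

text \<open>Fubini with \<open>x\<close> integrated first: every translate of \<open>J\<close> has
  mass 1. The equality of masses later makes the integral of \<open>rate\<close> vanish.\<close>

lemma space_conv_integrable:
  assumes h: "integrable lborel h"
  shows "integrable lborel (space_conv J h)" "(LINT x|lborel. space_conv J h x) = (LINT x|lborel. h x)"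
proof -
  note [measurable] = kernel_measurable
  have hm [measurable]: "h \<in> borel_measurable borel" using h by auto
  have J: "integrable lborel J" "(LINT x|lborel. J x) = 1"
    using stefan_kernelD(5,6)[OF K] .
  have int: "integrable (lborel \<Otimes>\<^sub>M lborel) (\<lambda>(y, x). J (x - y) * h y)"
  proof (rule lborel_pair.Fubini_integrable)
    have "(LINT x|lborel. norm (J (x - y) * h y)) = \<bar>h y\<bar>" for y
      using lborel_integrable_translate[OF J(1), of y] J(2) by (simp add: abs_mult kernel_nonneg)
    then show "integrable lborel (\<lambda>y. LINT x|lborel. norm (case (y, x) of (y, x) \<Rightarrow> J (x - y) * h y))"
      using h by simp
    show "AE y in lborel. integrable lborel (\<lambda>x. case (y, x) of (y, x) \<Rightarrow> J (x - y) * h y)"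
      using lborel_integrable_translate[OF J(1)] by auto
  qed measurable
  show "integrable lborel (space_conv J h)"
    using lborel_pair.integrable_snd[OF int] by (simp add: space_conv_def[abs_def])
  have "(LINT x|lborel. space_conv J h x) = (LINT y|lborel. LINT x|lborel. J (x - y) * h y)"
    unfolding space_conv_def by (rule lborel_pair.Fubini_integral[OF int])
  also have "\<dots> = (LINT y|lborel. h y)"
    using lborel_integrable_translate[OF J(1)] J(2) by simp
  finally show "(LINT x|lborel. space_conv J h x) = (LINT x|lborel. h x)" .
qed

lemma space_conv_diff:
  assumes "integrable lborel g" "integrable lborel h"
  shows "space_conv J (\<lambda>y. g y - h y) x = space_conv J g x - space_conv J h x"
  using conv_integrand_integrable[OF assms(1)] conv_integrand_integrable[OF assms(2)]
  by (simp add: space_conv_def right_diff_distrib)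

lemma space_conv_nonneg: "(\<And>y. 0 \<le> h y) \<Longrightarrow> 0 \<le> space_conv J h x"
  by (auto simp: space_conv_def kernel_nonneg intro!: integral_nonneg_AE)

lemma space_conv_mono_AE:
  assumes "integrable lborel g" "integrable lborel h" "AE y in lborel. g y \<le> h y"
  shows "space_conv J g x \<le> space_conv J h x"
  unfolding space_conv_def
  by (rule integral_mono_AE[OF conv_integrand_integrable[OF assms(1)] conv_integrand_integrable[OF assms(2)]])
     (use assms(3) in \<open>auto elim!: eventually_mono intro!: mult_left_mono simp: kernel_nonneg\<close>)

lemma L1_norm_space_conv_le:
  assumes h: "integrable lborel h"
  shows "L1_norm (space_conv J h) \<le> L1_norm h"
proof -
  have "L1_norm (space_conv J h) \<le> (LINT x|lborel. space_conv J (\<lambda>y. \<bar>h y\<bar>) x)"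
    unfolding L1_norm_def
  proof (rule integral_mono')
    show "integrable lborel (space_conv J (\<lambda>y. \<bar>h y\<bar>))"
      using h by (intro space_conv_integrable) auto
    show "\<bar>space_conv J h x\<bar> \<le> space_conv J (\<lambda>y. \<bar>h y\<bar>) x" for x
      using integral_abs_bound[of lborel "\<lambda>y. J (x - y) * h y"]
      by (simp add: space_conv_def abs_mult kernel_nonneg)
  qed (simp add: space_conv_nonneg)
  also have "\<dots> = L1_norm h"
    using space_conv_integrable(2)[of "\<lambda>y. \<bar>h y\<bar>"] h by (simp add: L1_norm_def)
  finally show ?thesis .
qed

lemma space_conv_le_Linf_norm:
  assumes h: "integrable lborel h" and nn: "\<And>y. 0 \<le> h y"
  shows "space_conv J h x \<le> Linf_norm J * (LINT y|lborel. h y)"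
proof -
  have "space_conv J h x \<le> (LINT y|lborel. Linf_norm J * h y)"
    unfolding space_conv_def using conv_integrand_integrable[OF h] h nn kernel_le_Linf_norm[OF K]
    by (intro integral_mono) (auto intro!: mult_right_mono)
  then show ?thesis by simp
qed

text \<open>If the integral were 0, its nonnegative integrand would vanish almost everywhere, hence
  so would \<open>h\<close> on \<open>V\<close>, and \<open>V\<close> would miss the support of
  \<open>h\<close>.\<close>

lemma space_conv_pos:
  assumes h: "integrable lborel h" and nn: "\<And>y. 0 \<le> h y"
    and V: "open V" "V \<inter> dist_supp h \<noteq> {}" and pos: "\<And>y. y \<in> V \<Longrightarrow> J (x - y) \<noteq> 0"
  shows "0 < space_conv J h x"
proof (rule ccontr)
  assume "\<not> 0 < space_conv J h x"
  then have "space_conv J h x = 0"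
    using space_conv_nonneg[of h x] nn by force
  then have "AE y in lborel. J (x - y) * h y = 0"
    unfolding space_conv_def
    using integral_nonneg_eq_0_iff_AE[OF conv_integrand_integrable[OF h, of x]] nn kernel_nonneg
    by auto
  then have "AE y in lborel. y \<in> V \<longrightarrow> h y = 0"
    by eventually_elim (use pos in auto)
  then have "y \<notin> dist_supp h" if "y \<in> V" for y
    using not_in_dist_supp_iff[OF h] V(1) that by blast
  then show False using V(2) by auto
qed

end

subsection \<open>Solutions\<close>

locale stefan_solution =
  fixes J f :: "'a::euclidean_space \<Rightarrow> real" and u :: "real \<Rightarrow> 'a \<Rightarrow> real" and R :: real
  assumes kernel: "stefan_kernel J R"
    and integrable_init: "integrable lborel f"
    and solution: "L1_solution J f u"
begin

section \<open>The equation as an evolution in L1, and its initial value\<close>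

definition rate :: "real \<Rightarrow> 'a \<Rightarrow> real" where
  "rate s x = space_conv J (temperature u s) x - temperature u s x"

lemma integrable_u: "0 \<le> t \<Longrightarrow> integrable lborel (u t)"
  using solution by (simp add: L1_solution_def L1_continuous_def)

lemma u_measurable: "0 \<le> t \<Longrightarrow> u t \<in> borel_measurable borel"
  using integrable_u[of t] by auto

lemma integrable_pos_part:
  fixes g :: "'a \<Rightarrow> real"
  assumes g: "integrable lborel g"
  shows "integrable lborel (\<lambda>x. max (g x - 1) 0)"
proof -
  have [measurable]: "g \<in> borel_measurable borel" using g by auto
  show ?thesis
    by (rule Bochner_Integration.integrable_bound[OF g]) auto
qed

lemma integrable_temperature: "0 \<le> t \<Longrightarrow> integrable lborel (temperature u t)"
  unfolding temperature_def by (intro integrable_pos_part integrable_u)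

lemma temperature_nonneg: "0 \<le> temperature u t x"
  by (simp add: temperature_def)

lemma integrable_rate: "0 \<le> t \<Longrightarrow> integrable lborel (rate t)"
  unfolding rate_def
  by (intro Bochner_Integration.integrable_diff space_conv_integrable(1)[OF kernel] integrable_temperature)

text \<open>Taking the positive part is 1-Lipschitz and convolution with \<open>J\<close> does not
  increase the L1 norm, so \<open>rate\<close> depends on \<open>u\<close> with Lipschitz constant
  2.\<close>

lemma L1_norm_rate_diff_le:
  assumes "0 \<le> s" "0 \<le> t"
  shows "L1_norm (\<lambda>x. rate s x - rate t x) \<le> 2 * L1_norm (\<lambda>x. u s x - u t x)"
proof -
  let ?w = "\<lambda>x. temperature u s x - temperature u t x"
  have w: "integrable lborel ?w"
    using assms integrable_temperature by auto
  have "L1_norm (\<lambda>x. rate s x - rate t x) \<le> L1_norm (space_conv J ?w) + L1_norm ?w"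
    using w space_conv_integrable(1)[OF kernel w] assms integrable_temperature
    by (intro L1_norm_triangle) (auto simp: rate_def space_conv_diff[OF kernel])
  also have "\<dots> \<le> 2 * L1_norm ?w"
    using L1_norm_space_conv_le[OF kernel w] by simp
  also have "L1_norm ?w \<le> L1_norm (\<lambda>x. u s x - u t x)"
    unfolding L1_norm_def using integrable_u assms
    by (intro integral_mono') (auto simp: temperature_def)
  finally show ?thesis by simp
qed

lemma rate_continuous:
  assumes "0 \<le> \<tau>" "e > 0"
  obtains d where "d > 0" "\<And>s. 0 \<le> s \<Longrightarrow> \<bar>s - \<tau>\<bar> < d \<Longrightarrow> L1_norm (\<lambda>x. rate s x - rate \<tau> x) < e"
    "\<And>s. 0 \<le> s \<Longrightarrow> \<bar>s - \<tau>\<bar> < d \<Longrightarrow> L1_norm (\<lambda>x. u s x - u \<tau> x) < e"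
proof -
  have "((\<lambda>s. L1_norm (\<lambda>x. u s x - u \<tau> x)) \<longlongrightarrow> 0) (at \<tau> within {0..})"
    using solution assms(1) by (simp add: L1_solution_def L1_continuous_def)
  \<comment> \<open>The half pays for the Lipschitz constant 2 of \<open>rate\<close>.\<close>
  then have "eventually (\<lambda>s. L1_norm (\<lambda>x. u s x - u \<tau> x) < e / 2) (at \<tau> within {0..})"
    using assms(2) by (intro order_tendstoD(2)) auto
  then obtain d where d: "d > 0"
    "\<And>s. s \<in> {0..} \<Longrightarrow> s \<noteq> \<tau> \<Longrightarrow> dist s \<tau> < d \<Longrightarrow> L1_norm (\<lambda>x. u s x - u \<tau> x) < e / 2"
    unfolding eventually_at by blast
  have *: "L1_norm (\<lambda>x. u s x - u \<tau> x) < e / 2" if "0 \<le> s" "\<bar>s - \<tau>\<bar> < d" for s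
    using d(2)[of s] that assms(2) by (cases "s = \<tau>") (auto simp: dist_real_def L1_norm_def)
  show ?thesis
  proof (rule that[OF d(1)])
    fix s assume s: "0 \<le> s" "\<bar>s - \<tau>\<bar> < d"
    show "L1_norm (\<lambda>x. rate s x - rate \<tau> x) < e"
      using L1_norm_rate_diff_le[OF s(1) assms(1)] *[OF s] by simp
    show "L1_norm (\<lambda>x. u s x - u \<tau> x) < e"
      using *[OF s] assms(2) by linarith
  qed
qed

text \<open>The case distinction makes \<open>gain\<close> the time integral of \<open>rate\<close> also at \<open>t = 0\<close>, where
  \<open>u 0 = f\<close> is not part of the definition of a solution but follows from its continuity.\<close>

definition gain :: "real \<Rightarrow> 'a \<Rightarrow> real" where
  "gain t x = (if t = 0 then 0 else u t x - f x)"

lemma has_L1_integral_gain: "0 \<le> t \<Longrightarrow> has_L1_integral rate (gain t) 0 t"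
proof (cases "t = 0")
  case True
  then show ?thesis
    using has_L1_integral_degenerate[of rate 0] integrable_rate[of 0] by (simp add: gain_def[abs_def])
next
  case False
  assume "0 \<le> t"
  with False solution show ?thesis
    by (simp add: L1_solution_def gain_def[abs_def] rate_def[abs_def])
qed

text \<open>For small \<open>b\<close>, \<open>u b\<close> is close to \<open>f\<close> by the
  integral equation and close to \<open>u 0\<close> by continuity.\<close>

lemma initial_value: "AE x in lborel. u 0 x = f x"
proof -
  let ?C = "L1_norm (rate 0)"
  have "L1_norm (\<lambda>x. u 0 x - f x) \<le> 0"
  proof (rule field_le_epsilon)
    fix e :: real assume "e > 0"
    \<comment> \<open>The bound 1 turns the error \<open>\<epsilon> * b\<close> into at most
      \<open>b\<close>; the bound \<open>e / 2\<close> serves the distance from \<open>u b\<close>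
      to \<open>u 0\<close>.\<close>
    define \<epsilon> where "\<epsilon> = min 1 (e / 2)"
    have \<epsilon>: "\<epsilon> > 0" using \<open>e > 0\<close> by (simp add: \<epsilon>_def)
    obtain d where d: "d > 0"
      "\<And>s. 0 \<le> s \<Longrightarrow> \<bar>s - 0\<bar> < d \<Longrightarrow> L1_norm (\<lambda>x. rate s x - rate 0 x) < \<epsilon>"
      "\<And>s. 0 \<le> s \<Longrightarrow> \<bar>s - 0\<bar> < d \<Longrightarrow> L1_norm (\<lambda>x. u s x - u 0 x) < \<epsilon>"
      using rate_continuous[OF order_refl \<epsilon>] by metis
    define b where "b = min (d / 2) (e / 2 / (1 + ?C))"
    have C: "?C \<ge> 0" by (rule L1_norm_nonneg)
    have b: "b > 0" "b < d"
      using d(1) C \<open>e > 0\<close> by (auto simp: b_def min_less_iff_disj)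
    have "b \<le> e / 2 / (1 + ?C)" by (simp only: b_def min.cobounded2)
    then have b_le: "b * (1 + ?C) \<le> e / 2"
      using C by (subst (asm) pos_le_divide_eq) auto
    have int: "integrable lborel (\<lambda>x. u b x - u 0 x)" "integrable lborel (rate 0)"
      "integrable lborel (\<lambda>x. gain b x - gain 0 x - (b - 0) * rate 0 x)"
      using integrable_u integrable_rate[of 0] b(1) integrable_init by (auto simp: gain_def)
    have approx: "L1_norm (\<lambda>x. gain b x - gain 0 x - (b - 0) * rate 0 x) \<le> \<epsilon> * (b - 0)"
      using b d(2) int
      by (intro has_L1_integral_increment_approx[where F = rate and c = 0] has_L1_integral_gain)
         (auto intro: less_imp_le)
    have "L1_norm (\<lambda>x. u b x - f x) \<le> L1_norm (\<lambda>x. gain b x - gain 0 x - (b - 0) * rate 0 x)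
        + L1_norm (\<lambda>x. b * rate 0 x)"
      using int b(1) by (intro L1_norm_triangle) (auto simp: gain_def)
    also have "\<dots> \<le> \<epsilon> * b + b * ?C"
      using approx b(1) by (simp add: L1_norm_scale)
    also have "\<dots> \<le> b * (1 + ?C)"
      using b(1) by (simp add: \<epsilon>_def algebra_simps)
    finally have "L1_norm (\<lambda>x. u b x - f x) \<le> e / 2" using b_le by linarith
    moreover have "L1_norm (\<lambda>x. u b x - u 0 x) \<le> e / 2"
      using d(3)[of b] b by (auto simp: \<epsilon>_def)
    moreover have "L1_norm (\<lambda>x. u 0 x - f x) \<le> L1_norm (\<lambda>x. u b x - f x) + L1_norm (\<lambda>x. u b x - u 0 x)"
      using integrable_u b(1) integrable_init by (intro L1_norm_triangle) auto
    ultimately show "L1_norm (\<lambda>x. u 0 x - f x) \<le> 0 + e" by linarith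
  qed
  then have "(LINT x|lborel. \<bar>u 0 x - f x\<bar>) = 0"
    using L1_norm_nonneg[of "\<lambda>x. u 0 x - f x"] unfolding L1_norm_def by linarith
  then have "AE x in lborel. \<bar>u 0 x - f x\<bar> = 0"
    using integrable_u[of 0] integrable_init
    by (subst (asm) integral_nonneg_eq_0_iff_AE) auto
  then show ?thesis by eventually_elim simp
qed

lemma u_eq_gain: "0 \<le> t \<Longrightarrow> AE x in lborel. u t x = f x + gain t x"
  by (cases "t = 0") (simp_all add: gain_def initial_value)

text \<open>A functional whose increments are controlled by the remainder of the first-order expansion of
  \<open>u\<close> taken at the right endpoint has nonpositive derivative.\<close>

lemma nonincreasing_of_increments:
  assumes t: "0 \<le> t"
    and inc: "\<And>a b. 0 \<le> a \<Longrightarrow> a \<le> b \<Longrightarrow>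
      \<Phi> b - \<Phi> a \<le> L1_norm (\<lambda>x. u b x - u a x - (b - a) * rate b x)"
  shows "\<Phi> t \<le> \<Phi> 0"
proof (rule field_le_epsilon)
  fix e :: real assume e: "e > 0"
  define \<epsilon> where "\<epsilon> = e / (1 + t)"
  have \<epsilon>: "\<epsilon> > 0" using e t by (simp add: \<epsilon>_def)
  \<comment> \<open>Interval induction tests all short intervals around \<open>\<tau>\<close>, also
    those reaching below time 0; the premise \<open>0 \<le> a\<close> excludes them.\<close>
  define P where "P a b \<longleftrightarrow> (0 \<le> a \<longrightarrow> \<Phi> b - \<Phi> a \<le> \<epsilon> * (b - a))" for a b
  have "P 0 t"
    using t
  proof (induction rule: Bolzano)
    case (trans a b c)
    then show ?case by (auto simp: P_def algebra_simps)
  next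
    case (local \<tau>)
    obtain d where d: "d > 0"
      "\<And>s. 0 \<le> s \<Longrightarrow> \<bar>s - \<tau>\<bar> < d \<Longrightarrow> L1_norm (\<lambda>x. rate s x - rate \<tau> x) < \<epsilon> / 2"
      using rate_continuous[OF local(1) half_gt_zero[OF \<epsilon>]] by metis
    have "\<Phi> b - \<Phi> a \<le> \<epsilon> * (b - a)" if ab: "a \<le> \<tau>" "\<tau> \<le> b" "b - a < d" "0 \<le> a" for a b
    proof -
      \<comment> \<open>Continuity is available at \<open>\<tau>\<close>, while the expansion is at
        \<open>b\<close>; passing through \<open>\<tau>\<close> costs two halves.\<close>
      have "L1_norm (\<lambda>x. rate s x - rate b x) \<le> \<epsilon>" if s: "s \<in> {a..b}" for s
      proof -
        have "L1_norm (\<lambda>x. rate s x - rate b x)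
            \<le> L1_norm (\<lambda>x. rate s x - rate \<tau> x) + L1_norm (\<lambda>x. rate b x - rate \<tau> x)"
          using integrable_rate ab s by (intro L1_norm_triangle) auto
        also have "\<dots> \<le> \<epsilon> / 2 + \<epsilon> / 2"
          using ab s by (intro add_mono less_imp_le[OF d(2)]) auto
        finally show ?thesis by simp
      qed
      then have approx: "L1_norm (\<lambda>x. gain b x - gain a x - (b - a) * rate b x) \<le> \<epsilon> * (b - a)"
        using ab integrable_rate
        by (intro has_L1_integral_increment_approx[where F = rate and c = 0] has_L1_integral_gain) auto
      have a: "0 \<le> a" and b: "0 \<le> b" using ab by auto
      have [measurable]: "u a \<in> borel_measurable borel" "u b \<in> borel_measurable borel"
        "f \<in> borel_measurable borel" "rate b \<in> borel_measurable borel"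
        using u_measurable a b integrable_init integrable_rate[OF b] by auto
      have [measurable]: "gain a \<in> borel_measurable borel" "gain b \<in> borel_measurable borel"
        unfolding gain_def by measurable
      have "L1_norm (\<lambda>x. u b x - u a x - (b - a) * rate b x)
          = L1_norm (\<lambda>x. gain b x - gain a x - (b - a) * rate b x)"
        unfolding L1_norm_def
        by (rule integral_cong_AE) (use u_eq_gain[OF a] u_eq_gain[OF b] in auto)
      with inc[of a b] approx ab show ?thesis by simp
    qed
    then show ?case
      unfolding P_def using d(1) by (intro exI[of _ d] conjI allI impI) simp_all
  qed
  then have "\<Phi> t - \<Phi> 0 \<le> \<epsilon> * t" by (simp add: P_def)
  also have "\<dots> \<le> e" using e t by (simp add: \<epsilon>_def field_simps)
  finally show "\<Phi> t \<le> \<Phi> 0 + e" by simp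
qed

text \<open>Where \<open>v(b) > 0\<close>, the increment of \<open>v\<close> is at most that of
  \<open>u\<close>; where \<open>v(b) = 0\<close>, \<open>rate b\<close> equals
  \<open>J * v(b)\<close> and is nonnegative. Hence the increment is at most the remainder plus
  \<open>(b - a) * rate b\<close>, whose integral is 0. The cases depend on the value at
  \<open>b\<close>, whence the expansion at the right endpoint.\<close>

lemma temperature_integral_le:
  assumes t: "0 \<le> t"
  shows "(LINT x|lborel. temperature u t x) \<le> L1_norm f"
proof -
  have "(LINT x|lborel. temperature u t x) \<le> (LINT x|lborel. temperature u 0 x)"
  proof (rule nonincreasing_of_increments[OF t])
    fix a b :: real assume ab: "0 \<le> a" "a \<le> b"
    let ?r = "\<lambda>x. u b x - u a x - (b - a) * rate b x"
    have b: "0 \<le> b" using ab by simp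
    have r: "integrable lborel ?r"
      using integrable_u[OF ab(1)] integrable_u[OF b] integrable_rate[OF b] by auto
    have pw: "temperature u b x - temperature u a x \<le> \<bar>?r x\<bar> + (b - a) * rate b x" for x
    proof (cases "u b x > 1")
      case True
      then have "temperature u b x - temperature u a x \<le> u b x - u a x"
        by (auto simp: temperature_def)
      then show ?thesis by linarith
    next
      case False
      then have v: "temperature u b x = 0" by (simp add: temperature_def)
      then have "(b - a) * rate b x \<ge> 0"
        using space_conv_nonneg[OF kernel temperature_nonneg] ab by (simp add: rate_def)
      then show ?thesis using v temperature_nonneg[of a x] by linarith
    qed
    have "(LINT x|lborel. temperature u b x) - (LINT x|lborel. temperature u a x)
        = (LINT x|lborel. temperature u b x - temperature u a x)"
      using integrable_temperature[OF ab(1)] integrable_temperature[OF b] by simp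
    also have "\<dots> \<le> (LINT x|lborel. \<bar>?r x\<bar> + (b - a) * rate b x)"
      by (rule integral_mono[OF _ _ pw])
         (use integrable_temperature[OF ab(1)] integrable_temperature[OF b] r integrable_rate[OF b] in auto)
    also have "\<dots> = L1_norm ?r + (b - a) * (LINT x|lborel. rate b x)"
      using r integrable_rate[OF b] by (simp add: L1_norm_def)
    also have "(LINT x|lborel. rate b x) = 0"
      using space_conv_integrable[OF kernel integrable_temperature[OF b]] integrable_temperature[OF b]
      by (simp add: rate_def)
    finally show "(LINT x|lborel. temperature u b x) - (LINT x|lborel. temperature u a x) \<le> L1_norm ?r"
      by simp
  qed
  also have "\<dots> \<le> L1_norm f"
    unfolding L1_norm_def
  proof (rule integral_mono_AE)
    show "AE x in lborel. temperature u 0 x \<le> \<bar>f x\<bar>"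
      using initial_value by eventually_elim (auto simp: temperature_def)
  qed (use integrable_temperature[of 0] integrable_init in auto)
  finally show ?thesis .
qed

text \<open>Since \<open>\<partial>\<^sub>t u \<ge> - (u - 1)\<^sub>+\<close>, the function \<open>e\<^sup>-\<^sup>t (f - 1)\<close> is a subsolution for \<open>u - 1\<close> where \<open>f > 1\<close>;
  \<open>Z\<close> measures how far \<open>u - 1\<close> falls below it.\<close>

lemma temperature_ge_initial:
  assumes t: "0 \<le> t"
  shows "AE x in lborel. exp (- t) * max (f x - 1) 0 \<le> temperature u t x"
proof -
  define Z where "Z s x = (if f x > 1 then max (exp (- s) * (f x - 1) - (u s x - 1)) 0 else 0)" for s x
  have fm [measurable]: "f \<in> borel_measurable borel" using integrable_init by auto
  have Z: "integrable lborel (Z s)" if s: "0 \<le> s" for s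
  proof (rule Bochner_Integration.integrable_bound[of _ "\<lambda>x. f x - u s x"])
    have [measurable]: "u s \<in> borel_measurable borel" using u_measurable[OF s] .
    show "Z s \<in> borel_measurable lborel" unfolding Z_def by measurable
    have "\<bar>Z s x\<bar> \<le> \<bar>f x - u s x\<bar>" for x
    proof (cases "f x > 1")
      case True
      then have "exp (- s) * (f x - 1) \<le> 1 * (f x - 1)"
        using s by (intro mult_right_mono) auto
      then have "exp (- s) * (f x - 1) - (u s x - 1) \<le> f x - u s x" by simp
      also have "\<dots> \<le> \<bar>f x - u s x\<bar>" by (rule abs_ge_self)
      finally show ?thesis using True by (simp add: Z_def)
    qed (simp add: Z_def)
    then show "AE x in lborel. norm (Z s x) \<le> norm (f x - u s x)" by simp
  qed (use integrable_u[OF s] integrable_init in auto)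
  have "(LINT x|lborel. Z t x) \<le> (LINT x|lborel. Z 0 x)"
  proof (rule nonincreasing_of_increments[OF t])
    fix a b :: real assume ab: "0 \<le> a" "a \<le> b"
    let ?r = "\<lambda>x. u b x - u a x - (b - a) * rate b x"
    have b: "0 \<le> b" using ab by simp
    have r: "integrable lborel ?r"
      using integrable_u[OF ab(1)] integrable_u[OF b] integrable_rate[OF b] by auto
    \<comment> \<open>The tangent inequality for \<open>exp\<close>, scaled by
      \<open>exp (- b)\<close>.\<close>
    have expo: "exp (- b) - exp (- a) \<le> - ((b - a) * exp (- b))"
    proof -
      have "exp (- b) * (1 + (b - a)) \<le> exp (- b) * exp (b - a)"
        by (intro mult_left_mono exp_ge_add_one_self) auto
      also have "\<dots> = exp (- a)" by (simp flip: exp_add)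
      finally show ?thesis by (simp add: algebra_simps)
    qed
    \<comment> \<open>Where \<open>Z b x > 0\<close>, up to the remainder \<open>u\<close> falls by
      at most \<open>(b - a) * temperature u b x\<close>, and the subsolution falls by at least
      \<open>(b - a) * (exp (- b) * (f x - 1))\<close>, which is no smaller.\<close>
    have pw: "Z b x - Z a x \<le> \<bar>?r x\<bar>" for x
    proof (cases "f x > 1 \<and> exp (- b) * (f x - 1) > u b x - 1")
      case True
      then have f1: "f x > 1" and less: "exp (- b) * (f x - 1) > u b x - 1" by auto
      have "Z b x - Z a x \<le> (exp (- b) - exp (- a)) * (f x - 1) - (u b x - u a x)"
        using f1 less by (auto simp: Z_def algebra_simps)
      also have "(exp (- b) - exp (- a)) * (f x - 1) \<le> - ((b - a) * exp (- b)) * (f x - 1)"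
        using expo f1 by (intro mult_right_mono) auto
      finally have "Z b x - Z a x \<le> - ((b - a) * (exp (- b) * (f x - 1))) - (u b x - u a x)"
        by (simp add: algebra_simps)
      moreover have "(b - a) * (- rate b x) \<le> (b - a) * (exp (- b) * (f x - 1))"
      proof (rule mult_left_mono)
        have "- rate b x \<le> temperature u b x"
          using space_conv_nonneg[OF kernel temperature_nonneg] by (simp add: rate_def)
        also have "\<dots> \<le> exp (- b) * (f x - 1)"
          using f1 less by (simp add: temperature_def)
        finally show "- rate b x \<le> exp (- b) * (f x - 1)" .
      qed (use ab in auto)
      ultimately show ?thesis by (simp add: abs_if)
    next
      case False
      then have "Z b x = 0" by (auto simp: Z_def)
      moreover have "Z a x \<ge> 0" by (simp add: Z_def)
      ultimately show ?thesis by linarith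
    qed
    have "(LINT x|lborel. Z b x) - (LINT x|lborel. Z a x) = (LINT x|lborel. Z b x - Z a x)"
      using Z[OF ab(1)] Z[OF b] by simp
    also have "\<dots> \<le> L1_norm ?r"
      unfolding L1_norm_def
      by (rule integral_mono[OF _ _ pw]) (use Z[OF ab(1)] Z[OF b] r in auto)
    finally show "(LINT x|lborel. Z b x) - (LINT x|lborel. Z a x) \<le> L1_norm ?r" .
  qed
  also have "(LINT x|lborel. Z 0 x) = 0"
    by (rule integral_eq_zero_AE) (use initial_value in \<open>auto elim!: eventually_mono simp: Z_def\<close>)
  finally have "(LINT x|lborel. Z t x) \<le> 0" .
  moreover have "(LINT x|lborel. Z t x) \<ge> 0"
    by (intro Bochner_Integration.integral_nonneg) (simp add: Z_def)
  ultimately have "(LINT x|lborel. Z t x) = 0" by (rule antisym)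
  then have "AE x in lborel. Z t x = 0"
    by (subst (asm) integral_nonneg_eq_0_iff_AE[OF Z[OF t]]) (auto simp: Z_def)
  then show ?thesis
  proof eventually_elim
    case (elim x)
    then show ?case
      by (cases "f x > 1") (auto simp: Z_def temperature_def max_def split: if_splits)
  qed
qed

subsection \<open>Supports before the critical time\<close>

abbreviation "S \<equiv> dist_supp f"

text \<open>Off \<open>S\<close> the solution starts at 0 and rises at speed at most
  \<open>?C\<close>, so it stays at most 1. Since the value 1 still gives temperature 0, the
  critical time is included.\<close>

lemma temperature_off_supp:
  assumes t: "0 \<le> t" "t * (Linf_norm J * L1_norm f) \<le> 1"
  shows "AE x in lborel. x \<notin> S \<longrightarrow> temperature u t x = 0"
proof -
  let ?C = "Linf_norm J * L1_norm f"
  have "0 \<le> Linf_norm J"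
    using kernel_nonneg[OF kernel, of 0] kernel_le_Linf_norm[OF kernel, of 0] by linarith
  have le: "rate s x \<le> ?C" if s: "0 \<le> s" for s x
  proof -
    have "rate s x \<le> space_conv J (temperature u s) x"
      using temperature_nonneg[of s x] by (simp add: rate_def)
    also have "\<dots> \<le> Linf_norm J * (LINT x|lborel. temperature u s x)"
      by (rule space_conv_le_Linf_norm[OF kernel integrable_temperature[OF s] temperature_nonneg])
    also have "\<dots> \<le> ?C"
      using temperature_integral_le[OF s] \<open>0 \<le> Linf_norm J\<close> by (rule mult_left_mono)
    finally show ?thesis .
  qed
  have "AE x in lborel. x \<in> UNIV \<longrightarrow> gain t x \<le> (t - 0) * ?C"
    by (rule has_L1_integral_AE_le[OF has_L1_integral_gain[OF t(1)] t(1)]) (use le in auto)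
  then show ?thesis
    using AE_eq_0_off_dist_supp[OF integrable_init] u_eq_gain[OF t(1)]
    by eventually_elim (use t(2) in \<open>auto simp: temperature_def\<close>)
qed

context
  fixes t :: real
  assumes t_pos: "0 < t" and t_le: "t * (Linf_norm J * L1_norm f) \<le> 1"
begin

lemma temperature_off_supp_before:
  assumes s: "s \<in> {0..t}"
  shows "AE x in lborel. x \<notin> S \<longrightarrow> temperature u s x = 0"
proof (rule temperature_off_supp)
  have "0 \<le> Linf_norm J"
    using kernel_nonneg[OF kernel, of 0] kernel_le_Linf_norm[OF kernel, of 0] by linarith
  then have "s * (Linf_norm J * L1_norm f) \<le> t * (Linf_norm J * L1_norm f)"
    using s by (intro mult_right_mono mult_nonneg_nonneg L1_norm_nonneg) auto
  then show "s * (Linf_norm J * L1_norm f) \<le> 1" using t_le by linarith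
qed (use s in auto)

text \<open>One inclusion is the vanishing off \<open>S\<close>; the other follows from the lower
  bound by \<open>exp (- t) * max (f x - 1) 0\<close>, whose support is \<open>S\<close> by
  assumption.\<close>

lemma dist_supp_temperature:
  assumes S: "S = dist_supp (\<lambda>x. max (f x - 1) 0)"
  shows "dist_supp (temperature u t) = S"
proof -
  have "x \<notin> dist_supp (temperature u t) \<longleftrightarrow> x \<notin> S" for x
  proof
    assume "x \<notin> S"
    then show "x \<notin> dist_supp (temperature u t)"
      using temperature_off_supp_before[of t] t_pos closed_dist_supp[of f]
      by (subst not_in_dist_supp_iff[OF integrable_temperature]) (auto intro!: exI[of _ "- S"])
  next
    assume "x \<notin> dist_supp (temperature u t)"
    then obtain U where U: "open U" "x \<in> U" "AE y in lborel. y \<in> U \<longrightarrow> temperature u t y = 0"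
      using t_pos by (subst (asm) not_in_dist_supp_iff[OF integrable_temperature]) auto
    have "AE y in lborel. y \<in> U \<longrightarrow> max (f y - 1) 0 = 0"
      using U(3) temperature_ge_initial[OF less_imp_le[OF t_pos]]
    proof eventually_elim
      case (elim y)
      show ?case
      proof
        assume "y \<in> U"
        with elim have "exp (- t) * max (f y - 1) 0 \<le> 0" by simp
        then show "max (f y - 1) 0 = 0"
          by (auto simp: mult_le_0_iff)
      qed
    qed
    then show "x \<notin> S"
      unfolding S not_in_dist_supp_iff[OF integrable_pos_part[OF integrable_init]] using U by blast
  qed
  then show ?thesis by blast
qed

text \<open>For \<open>y\<close> in \<open>S\<close> the kernel vanishes at \<open>x - y\<close>,
  and for other \<open>y\<close> the temperature vanishes, so nothing is received at
  \<open>x\<close>.\<close>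

lemma u_eq_0_far_from_supp:
  "AE x in lborel. x \<notin> S \<and> R < infdist x S \<longrightarrow> u t x = 0"
proof -
  define A where "A = {x. x \<notin> S \<and> R < infdist x S}"
  have "open {x. R < infdist x S}"
    by (intro open_Collect_less continuous_intros)
  then have "open A"
    unfolding A_def using closed_dist_supp[of f] by (intro open_Collect_conj) (auto simp: closed_def Compl_eq)
  then have [measurable]: "A \<in> sets borel" by simp
  have rate0: "AE x in lborel. x \<in> A \<longrightarrow> rate s x = 0" if s: "s \<in> {0..t}" for s
  proof -
    have "space_conv J (temperature u s) x = 0" if x: "x \<in> A" for x
      unfolding space_conv_def
    proof (rule integral_eq_zero_AE)
      show "AE y in lborel. J (x - y) * temperature u s y = 0"
        using temperature_off_supp_before[OF s]
      proof eventually_elim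
        case (elim y)
        show ?case
        proof (cases "y \<in> S")
          case True
          then have "R < dist x y"
            using x infdist_le[OF True, of x] by (auto simp: A_def)
          then have "x - y \<notin> cball 0 R" by (simp add: dist_norm norm_minus_commute)
          then have "J (x - y) = 0"
            using stefan_kernelD(4)[OF kernel] closure_subset[of "{x. J x \<noteq> 0}"] by blast
          then show ?thesis by simp
        qed (use elim in simp)
      qed
    qed
    then show ?thesis
      using temperature_off_supp_before[OF s]
      by (auto elim!: eventually_mono simp: rate_def A_def)
  qed
  \<comment> \<open>Both signs are prepared because the comparison rule bounds integrals only from
    above.\<close>
  have rate0_le: "AE x in lborel. x \<in> A \<longrightarrow> rate s x \<le> 0"
    "AE x in lborel. x \<in> A \<longrightarrow> - rate s x \<le> 0" if s: "s \<in> {0..t}" for s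
    using rate0[OF s] by (auto elim!: eventually_mono)
  have "AE x in lborel. x \<in> A \<longrightarrow> gain t x \<le> (t - 0) * 0"
    using t_pos rate0_le(1) by (intro has_L1_integral_AE_le[OF has_L1_integral_gain]) auto
  moreover have "AE x in lborel. x \<in> A \<longrightarrow> - gain t x \<le> (t - 0) * 0"
    using t_pos rate0_le(2)
    by (intro has_L1_integral_AE_le[OF has_L1_integral_uminus[OF has_L1_integral_gain]]) auto
  ultimately show ?thesis
    using AE_eq_0_off_dist_supp[OF integrable_init] u_eq_gain[OF less_imp_le[OF t_pos]]
    by eventually_elim (auto simp: A_def)
qed

text \<open>Off \<open>S\<close> the rate is \<open>J * v(s)\<close>. Replacing
  \<open>exp (- s)\<close> by the smaller \<open>exp (- t)\<close> makes its lower bound independent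
  of \<open>s\<close>, as the comparison rule requires.\<close>

lemma u_ge_conv_off_supp:
  "AE x in lborel. x \<notin> S \<longrightarrow>
     t * (exp (- t) * space_conv J (\<lambda>x. max (f x - 1) 0) x) \<le> u t x"
proof -
  let ?g = "\<lambda>x. max (f x - 1) 0"
  let ?G = "\<lambda>x. exp (- t) * space_conv J ?g x"
  have g: "integrable lborel ?g" by (rule integrable_pos_part[OF integrable_init])
  have conv: "space_conv J (\<lambda>x. exp (- t) * ?g x) x = ?G x" for x
    unfolding space_conv_def by (subst integral_mult_right_zero[symmetric]) (simp only: mult.left_commute)
  have [measurable]: "space_conv J ?g \<in> borel_measurable borel"
    using space_conv_integrable(1)[OF kernel g] by auto
  have "AE x in lborel. x \<in> - S \<longrightarrow> - rate s x \<le> - ?G x" if s: "s \<in> {0..t}" for s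
    using temperature_off_supp_before[OF s]
  proof eventually_elim
    case (elim x)
    have "exp (- t) * ?g y \<le> exp (- s) * ?g y" for y
      using s by (intro mult_right_mono) auto
    moreover have "AE y in lborel. exp (- s) * ?g y \<le> temperature u s y"
      using temperature_ge_initial[of s] s by simp
    ultimately have "AE y in lborel. exp (- t) * ?g y \<le> temperature u s y"
      by (auto elim!: eventually_mono intro: order_trans)
    then have "?G x \<le> space_conv J (temperature u s) x"
      unfolding conv[symmetric] using g integrable_temperature[of s] s
      by (intro space_conv_mono_AE[OF kernel]) auto
    with elim show ?case by (simp add: rate_def)
  qed
  then have "AE x in lborel. x \<in> - S \<longrightarrow> - gain t x \<le> (t - 0) * - ?G x"
    using t_pos closed_dist_supp[of f]
    by (intro has_L1_integral_AE_le[OF has_L1_integral_uminus[OF has_L1_integral_gain]]) auto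
  then show ?thesis
    using AE_eq_0_off_dist_supp[OF integrable_init] u_eq_gain[OF less_imp_le[OF t_pos]]
    by eventually_elim auto
qed

lemma dist_supp_u_diff:
  assumes S: "S = dist_supp (\<lambda>x. max (f x - 1) 0)" and "S \<noteq> {}"
  shows "dist_supp (u t) - S = {x. 0 < infdist x S \<and> infdist x S \<le> R}"
proof -
  let ?g = "\<lambda>x. max (f x - 1) 0"
  have clS: "closed S" by (rule closed_dist_supp)
  have g: "integrable lborel ?g" by (rule integrable_pos_part[OF integrable_init])
  have ut: "integrable lborel (u t)" using integrable_u t_pos by simp
  \<comment> \<open>\<open>infdist\<close> to the empty set is 0 by convention, so nonemptiness of
    \<open>S\<close> enters here.\<close>
  have off: "x \<notin> S \<longleftrightarrow> 0 < infdist x S" for x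
    using in_closed_iff_infdist_zero[OF clS \<open>S \<noteq> {}\<close>, of x] infdist_nonneg[of x S] by linarith
  have "x \<in> dist_supp (u t) \<longleftrightarrow> infdist x S \<le> R" if x: "x \<notin> S" for x
  proof
    assume "x \<in> dist_supp (u t)"
    show "infdist x S \<le> R"
    proof (rule ccontr)
      assume "\<not> infdist x S \<le> R"
      let ?U = "{x. x \<notin> S \<and> R < infdist x S}"
      have "open {x. R < infdist x S}"
        by (intro open_Collect_less continuous_intros)
      then have "open ?U"
        using clS by (intro open_Collect_conj) (auto simp: closed_def Compl_eq)
      moreover have "x \<in> ?U" using x \<open>\<not> infdist x S \<le> R\<close> by simp
      moreover have "AE y in lborel. y \<in> ?U \<longrightarrow> u t y = 0" using u_eq_0_far_from_supp by simp
      ultimately have "x \<notin> dist_supp (u t)"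
        unfolding not_in_dist_supp_iff[OF ut] by blast
      with \<open>x \<in> dist_supp (u t)\<close> show False by simp
    qed
  next
    assume le: "infdist x S \<le> R"
    show "x \<in> dist_supp (u t)"
    proof (rule ccontr)
      assume "x \<notin> dist_supp (u t)"
      then obtain U where U: "open U" "x \<in> U" "AE y in lborel. y \<in> U \<longrightarrow> u t y = 0"
        unfolding not_in_dist_supp_iff[OF ut] by blast
      obtain b where b: "b \<in> S" "infdist x S = dist x b"
        using infdist_attains_inf[OF clS \<open>S \<noteq> {}\<close>] by blast
      define W where "W = U - S"
      have W: "open W" "x \<in> W"
        using U clS x by (auto simp: W_def)
      \<comment> \<open>\<open>J\<close> may vanish at \<open>x - b\<close> itself, but this point
        is in the closure of \<open>{y. J y \<noteq> 0}\<close>, so \<open>x\<close> can be moved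
        within \<open>W\<close> to a point \<open>z\<close> with
        \<open>J (z - b) \<noteq> 0\<close>.\<close>
      have "x - b \<in> closure {y. J y \<noteq> 0}"
        using le b stefan_kernelD(4)[OF kernel] by (simp add: dist_norm norm_minus_commute)
      moreover have "open ((\<lambda>y. y - b) ` W)"
        using open_translation_subtract[OF W(1)] .
      ultimately have "{y. J y \<noteq> 0} \<inter> (\<lambda>y. y - b) ` W \<noteq> {}"
        using W(2) open_Int_closure_eq_empty[of "(\<lambda>y. y - b) ` W" "{y. J y \<noteq> 0}"] by blast
      then obtain z where z: "z \<in> W" "J (z - b) \<noteq> 0" by auto
      have "open {y. J y \<noteq> 0}"
        using stefan_kernelD(1)[OF kernel] by (intro open_Collect_neq) auto
      then obtain e where e: "e > 0" "ball (z - b) e \<subseteq> {y. J y \<noteq> 0}"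
        using z(2) open_contains_ball by blast
      \<comment> \<open>The radius \<open>e\<close> is shared equally: \<open>y\<close> near
        \<open>z\<close> and \<open>c\<close> near \<open>b\<close> keep \<open>y - c\<close> in the
        ball around \<open>z - b\<close>.\<close>
      have pos: "0 < space_conv J ?g y" if y: "y \<in> ball z (e / 2)" for y
      proof (rule space_conv_pos[OF kernel g])
        show "ball b (e / 2) \<inter> dist_supp ?g \<noteq> {}"
          using b(1) e(1) unfolding S[symmetric] by (auto simp: disjoint_iff intro!: exI[of _ b])
        fix c assume "c \<in> ball b (e / 2)"
        with y have "norm (z - y) < e / 2" "norm (b - c) < e / 2"
          by (auto simp: dist_norm)
        then have "norm ((z - y) - (b - c)) < e"
          using norm_triangle_ineq4[of "z - y" "b - c"] by linarith
        then have "y - c \<in> ball (z - b) e"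
          by (simp add: dist_norm algebra_simps)
        then show "J (y - c) \<noteq> 0" using e(2) by blast
      qed auto
      \<comment> \<open>On this open set around \<open>z\<close>, \<open>u t\<close> is positive
        almost everywhere by the lower bound, yet 0 almost everywhere as part of
        \<open>U\<close>.\<close>
      have "AE y in lborel. y \<notin> W \<inter> ball z (e / 2)"
        using U(3) u_ge_conv_off_supp
      proof eventually_elim
        case (elim y)
        show ?case
        proof
          assume y: "y \<in> W \<inter> ball z (e / 2)"
          then have "0 < t * (exp (- t) * space_conv J ?g y)"
            using t_pos pos by simp
          with elim y show False by (auto simp: W_def)
        qed
      qed
      then have "W \<inter> ball z (e / 2) = {}"
        using W(1) by (intro open_AE_not_in_imp_empty) auto
      with z(1) e(1) show False by auto
    qed
  qed
  then show ?thesis using off by blast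
qed

end

end

text \<open>A point at distance exactly \<open>R\<close> is a limit of points farther away, hence
  not interior; the set with both inequalities strict is open.\<close>

lemma interior_infdist_annulus:
  assumes "no_local_max_of_dist S R"
  shows "interior {x. 0 < infdist x S \<and> infdist x S \<le> R} = {x. 0 < infdist x S \<and> infdist x S < R}"
proof
  show "interior {x. 0 < infdist x S \<and> infdist x S \<le> R} \<subseteq> {x. 0 < infdist x S \<and> infdist x S < R}"
  proof
    fix x assume x: "x \<in> interior {x. 0 < infdist x S \<and> infdist x S \<le> R}"
    then have le: "0 < infdist x S" "infdist x S \<le> R"
      using interior_subset by blast+
    have "infdist x S \<noteq> R"
    proof
      assume "infdist x S = R"
      then have "x \<in> closure {y. R < infdist y S}"
        using assms by (simp add: no_local_max_of_dist_def)
      then have "interior {x. 0 < infdist x S \<and> infdist x S \<le> R} \<inter> {y. R < infdist y S} \<noteq> {}"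
        using x open_Int_closure_eq_empty[OF open_interior] by blast
      then show False using interior_subset by fastforce
    qed
    with le show "x \<in> {x. 0 < infdist x S \<and> infdist x S < R}" by simp
  qed
  have "open {x. 0 < infdist x S \<and> infdist x S < R}"
    by (intro open_Collect_conj open_Collect_less continuous_intros)
  then show "{x. 0 < infdist x S \<and> infdist x S < R} \<subseteq> interior {x. 0 < infdist x S \<and> infdist x S \<le> R}"
    by (intro interior_maximal) auto
qed

theorem theorem3p14:
  fixes J f :: "'a::euclidean_space \<Rightarrow> real"
    and u :: "real \<Rightarrow> 'a \<Rightarrow> real"
    and R\<^sub>J :: real
  assumes "stefan_kernel J R\<^sub>J"
    and "integrable lborel f"
    and "AE x in lborel. 0 \<le> f x"
    and "\<not> (AE x in lborel. f x = 0)"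
    and "dist_supp f = dist_supp (\<lambda>x. max (f x - 1) 0)"
    and "L1_solution J f u"
  shows "(no_local_max_of_dist (dist_supp f) R\<^sub>J \<longrightarrow>
            (\<forall>t\<in>{0<..1 / (Linf_norm J * L1_norm f)}.
               mushy_region u t = {x. 0 < infdist x (dist_supp f) \<and> infdist x (dist_supp f) < R\<^sub>J}))
       \<and> (\<forall>t\<in>{0<..1 / (Linf_norm J * L1_norm f)}.
            mushy_region u t = interior {x. 0 < infdist x (dist_supp f) \<and> infdist x (dist_supp f) \<le> R\<^sub>J})"
proof -
  interpret stefan_solution J f u R\<^sub>J
    using assms by unfold_locales
  have nonempty: "dist_supp f \<noteq> {}"
    using AE_eq_0_off_dist_supp[OF assms(2)] assms(4) by auto
  have main: "mushy_region u t
      = interior {x. 0 < infdist x (dist_supp f) \<and> infdist x (dist_supp f) \<le> R\<^sub>J}"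
    if t: "t \<in> {0<..1 / (Linf_norm J * L1_norm f)}" for t
  proof -
    \<comment> \<open>The range of times is empty unless the product of norms is positive, also when
      it is 0, since \<open>1 / 0 = 0\<close>.\<close>
    have "0 < 1 / (Linf_norm J * L1_norm f)"
      using t unfolding greaterThanAtMost_iff by (elim conjE) (rule less_le_trans)
    then have "0 < Linf_norm J * L1_norm f"
      by (simp only: zero_less_divide_1_iff)
    from pos_le_divide_eq[OF this, of t 1] have le: "t * (Linf_norm J * L1_norm f) \<le> 1"
      using t by simp
    have "0 < t" using t by simp
    show ?thesis
      unfolding mushy_region_def dist_supp_temperature[OF \<open>0 < t\<close> le assms(5)]
        dist_supp_u_diff[OF \<open>0 < t\<close> le assms(5) nonempty] ..
  qed
  with interior_infdist_annulus[of "dist_supp f" R\<^sub>J] show ?thesis by auto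
qed

end
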